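(* Let $V$ be a finite dimensional euclidean vector space over $\mathbf{R}$, let $1\le p<2$, and let $\gamma:[0,T]\to V$ be a continuous path of finite $p$-variation with image $S_\gamma=\gamma([0,T])$. Let $f:S_\gamma\to\mathbf{C}$ be a Lipschitz function such that the convex hull $\mathrm{h}(f(S_\gamma))$ does not contain $0$, and let $\log$ be a continuous branch of the logarithm on $f(S_\gamma)$. Then the expression $$I^f_\gamma(E,g,h)=\int_\gamma (E\circ\log\circ f)\,g\,dh$$ defines a $\mathbf{C}$-trilinear map $I^f_\gamma:\mathcal{O}(\mathbf{C})\times\mathrm{Lip}(S_\gamma)\times\mathrm{Lip}(S_\gamma)\to\mathbf{C}$ which satisfies, for all $E\in\mathcal{O}(\mathbf{C})$ and $g,h\in\mathrm{Lip}(S_\gamma)$, $$|I^f_\gamma(E,g,h)|\le\frac{1}{1-2^{1-2/p}}\,M(E,f,g)\,\|h\|_{\mathrm{Lip}(S_\gamma)}\,\|\gamma\|_{p;[0,T]}^2+|E(\log f(\gamma(0)))|\,|g(\gamma(0))|\,|h(\gamma(T))-h(\gamma(0))|.$$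
   Context: $\mathcal{O}(\mathbf{C})$ is the space of entire functions; $\mathrm{Lip}(S_\gamma)$ is the space of Lipschitz functions $S_\gamma\to\mathbf{C}$ (metric inherited from $V$), and $\|u\|_{\mathrm{Lip}(S_\gamma)}$ is the Lipschitz constant (seminorm) of $u$. $\|\gamma\|_{p;[0,T]}=\left(\sup\sum_i|\gamma(t_{i+1})-\gamma(t_i)|^p\right)^{1/p}$, the supremum over partitions of $[0,T]$. The integral $\int_\gamma u\,dh$ is the Young integral $\int_0^T(u\circ\gamma)\,d(h\circ\gamma)$ (limit of Riemann–Stieltjes sums). Since $f(S_\gamma)$ is connected and $0\notin\mathrm{h}(f(S_\gamma))$, the branch $\log$ extends uniquely to a continuous branch of the logarithm on $\mathrm{h}(f(S_\gamma))$, also denoted $\log$. The quantity $M$ is $$M(E,f,g)=\|g\|_{\mathrm{Lip}(S_\gamma)}\max_{f(S_\gamma)}|E\circ\log|+\frac{\|f\|_{\mathrm{Lip}(S_\gamma)}\,\max_{S_\gamma}|g|\,\max_{\mathrm{h}(f(S_\gamma))}|E'\circ\log|}{\mathrm{dist}(0,\mathrm{h}(f(S_\gamma)))}.$$ *)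

theory Defs
  imports "HOL-Analysis.Analysis"
begin

section \<open>Paths of finite $p$-variation\<close>

definition is_partition :: "real \<Rightarrow> real \<Rightarrow> nat \<Rightarrow> (nat \<Rightarrow> real) \<Rightarrow> bool" where
  "is_partition a b n t \<longleftrightarrow> t 0 = a \<and> t n = b \<and> (\<forall>i<n. t i < t (Suc i))"

definition variation_sums :: "real \<Rightarrow> real \<Rightarrow> real \<Rightarrow> (real \<Rightarrow> 'v::real_normed_vector) \<Rightarrow> real set" where
  "variation_sums p a b \<gamma> =
     {(\<Sum>i<n. norm (\<gamma> (t (Suc i)) - \<gamma> (t i)) powr p) | n t. is_partition a b n t}"

definition finite_p_variation :: "real \<Rightarrow> real \<Rightarrow> real \<Rightarrow> (real \<Rightarrow> 'v::real_normed_vector) \<Rightarrow> bool" where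
  "finite_p_variation p a b \<gamma> \<longleftrightarrow> bdd_above (variation_sums p a b \<gamma>)"

definition p_variation :: "real \<Rightarrow> real \<Rightarrow> real \<Rightarrow> (real \<Rightarrow> 'v::real_normed_vector) \<Rightarrow> real" where
  "p_variation p a b \<gamma> = Sup (variation_sums p a b \<gamma>) powr (1 / p)"

section \<open>Lipschitz functions and entire functions\<close>

text \<open>A function on \<open>S\<close> is represented by a total function of which only the values on \<open>S\<close>
  matter.\<close>

definition Lip :: "'v::metric_space set \<Rightarrow> ('v \<Rightarrow> complex) set" where
  "Lip S = {u. \<exists>C. C-lipschitz_on S u}"

text \<open>The least Lipschitz constant of \<open>u \<in> Lip S\<close>. The infimum over all constants, rather than the
  supremum of the difference quotients, also gives the right value \<open>0\<close> when \<open>S\<close> is a single point.\<close>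

definition Lip_seminorm :: "'v::metric_space set \<Rightarrow> ('v \<Rightarrow> complex) \<Rightarrow> real" where
  "Lip_seminorm S u = Inf {C. C-lipschitz_on S u}"

definition entire_functions :: "(complex \<Rightarrow> complex) set" where
  "entire_functions = {E. E holomorphic_on UNIV}"

section \<open>Branches of the logarithm\<close>

definition log_branch :: "complex set \<Rightarrow> (complex \<Rightarrow> complex) \<Rightarrow> bool" where
  "log_branch A L \<longleftrightarrow> continuous_on A L \<and> (\<forall>z\<in>A. exp (L z) = z)"

text \<open>The extension of the branch \<open>L\<close> on \<open>A\<close> to a branch on the convex hull of \<open>A\<close>;
  \<open>extensional\<close> only fixes the irrelevant values off the hull, so that the extension is unique as a
  total function.\<close>

definition log_hull :: "complex set \<Rightarrow> (complex \<Rightarrow> complex) \<Rightarrow> complex \<Rightarrow> complex" where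
  "log_hull A L = (THE G. G \<in> extensional (convex hull A) \<and>
     log_branch (convex hull A) G \<and> (\<forall>z\<in>A. G z = L z))"

lemma log_branch_diff_constant:
  assumes "log_branch A L" "log_branch A G" "connected A"
  shows "\<exists>c. \<forall>z\<in>A. L z - G z = c"
proof -
  have "(\<lambda>z. L z - G z) constant_on A"
  proof (rule continuous_discrete_range_constant [OF \<open>connected A\<close>])
    show "continuous_on A (\<lambda>z. L z - G z)"
      using assms by (intro continuous_intros) (auto simp: log_branch_def)
    fix x assume "x \<in> A"
    show "\<exists>e>0. \<forall>y. y \<in> A \<and> L y - G y \<noteq> L x - G x \<longrightarrow> e \<le> norm ((L y - G y) - (L x - G x))"
    proof (intro exI conjI allI impI)
      show "2 * pi > 0" by simp
      fix y assume y: "y \<in> A \<and> L y - G y \<noteq> L x - G x"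
      have nz: "exp (G z) = z \<and> exp (L z) = z \<and> z \<noteq> 0" if "z \<in> A" for z
        using that assms unfolding log_branch_def by (metis exp_not_eq_zero)
      then have "exp (L y - G y) = exp (L x - G x)"
        using y \<open>x \<in> A\<close> by (simp add: exp_diff)
      then obtain n where n: "L y - G y = (L x - G x) + of_int (2 * n) * pi * \<i>"
        by (auto simp: exp_eq)
      then have "n \<noteq> 0" using y by auto
      then have "1 \<le> \<bar>real_of_int n\<bar>" by (metis of_int_1_le_iff of_int_abs zero_less_abs_iff int_one_le_iff_zero_less)
      moreover have "norm ((L y - G y) - (L x - G x)) = 2 * \<bar>real_of_int n\<bar> * pi"
        using n by (simp add: norm_mult)
      ultimately show "2 * pi \<le> norm ((L y - G y) - (L x - G x))" by simp
    qed
  qed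
  then show ?thesis by (auto simp: constant_on_def)
qed

lemma log_hull_unique_extension:
  assumes L: "log_branch A L" and A: "connected A" "A \<noteq> {}" and 0: "0 \<notin> convex hull A"
  shows "\<exists>!G. G \<in> extensional (convex hull A) \<and>
           log_branch (convex hull A) G \<and> (\<forall>z\<in>A. G z = L z)"
proof -
  let ?H = "convex hull A"
  have AH: "A \<subseteq> ?H" by (rule hull_subset)
  have "contractible ?H" by (simp add: convex_imp_contractible)
  then obtain G0 where G0: "continuous_on ?H G0" "\<And>z. z \<in> ?H \<Longrightarrow> z = exp (G0 z)"
    using continuous_logarithm_on_contractible [OF continuous_on_id, of ?H] 0 by metis
  then have "log_branch A G0"
    using AH continuous_on_subset unfolding log_branch_def by (metis subsetD)
  then obtain c where c: "\<And>z. z \<in> A \<Longrightarrow> L z - G0 z = c"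
    using log_branch_diff_constant [OF L _ A(1)] by blast
  have ec: "exp c = 1"
  proof -
    obtain a where a: "a \<in> A" using A by blast
    have "exp (L a) = a" "exp (G0 a) = a" "a \<noteq> 0"
      using a AH L G0(2) 0 unfolding log_branch_def by (auto simp: subset_iff)
    then show ?thesis using c [OF a] by (metis exp_diff divide_self)
  qed
  define G where "G = restrict (\<lambda>z. G0 z + c) ?H"
  have "continuous_on ?H G"
    unfolding G_def using G0(1) by (auto intro!: continuous_intros cong: continuous_on_cong)
  then have "log_branch ?H G"
    using G0(2) ec by (auto simp: log_branch_def G_def exp_add)
  moreover have "G z = L z" if "z \<in> A" for z
    using c [OF that] that AH by (auto simp: G_def algebra_simps)
  ultimately have ex: "G \<in> extensional ?H \<and> log_branch ?H G \<and> (\<forall>z\<in>A. G z = L z)"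
    by (auto simp: G_def)
  show ?thesis
  proof (rule ex1I)
    show "G \<in> extensional ?H \<and> log_branch ?H G \<and> (\<forall>z\<in>A. G z = L z)" by (fact ex)
  next
    fix G' assume G': "G' \<in> extensional ?H \<and> log_branch ?H G' \<and> (\<forall>z\<in>A. G' z = L z)"
    then obtain d where d: "\<And>z. z \<in> ?H \<Longrightarrow> G' z - G z = d"
      using log_branch_diff_constant [of ?H G' G] ex convex_connected [of ?H] by auto
    obtain a where a: "a \<in> A" using A by blast
    then have "d = 0" using d [of a] AH ex G' by auto
    then show "G' = G" using d ex G' by (intro extensionalityI [of _ ?H]) auto
  qed
qed

section \<open>The Young integral\<close>

text \<open>Limit of the Riemann--Stieltjes sums, with arbitrary intermediate points, as the mesh of the
  partition tends to \<open>0\<close>.\<close>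

definition has_young_integral ::
  "real \<Rightarrow> real \<Rightarrow> (real \<Rightarrow> complex) \<Rightarrow> (real \<Rightarrow> complex) \<Rightarrow> complex \<Rightarrow> bool" where
  "has_young_integral a b x y I \<longleftrightarrow>
     (\<forall>e>0. \<exists>d>0. \<forall>n t s.
        is_partition a b n t \<and> (\<forall>i<n. t (Suc i) - t i < d) \<and> (\<forall>i<n. s i \<in> {t i..t (Suc i)}) \<longrightarrow>
        norm ((\<Sum>i<n. x (s i) * (y (t (Suc i)) - y (t i))) - I) < e)"

definition young_integral :: "real \<Rightarrow> real \<Rightarrow> (real \<Rightarrow> complex) \<Rightarrow> (real \<Rightarrow> complex) \<Rightarrow> complex" where
  "young_integral a b x y = (THE I. has_young_integral a b x y I)"

lemma fine_partition_exists:
  assumes "a \<le> b" "0 < d"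
  shows "\<exists>n t. is_partition a b n t \<and> (\<forall>i<n. t (Suc i) - t i < d)"
proof (cases "a = b")
  case True
  then show ?thesis by (intro exI [of _ 0] exI [of _ "\<lambda>_. a"]) (simp add: is_partition_def)
next
  case False
  with assms have ab: "a < b" by simp
  obtain n :: nat where n: "(b - a) / d < real n" using reals_Archimedean2 by blast
  then have n0: "0 < real n" using ab assms by (smt (verit) divide_pos_pos)
  define w where "w = (b - a) / real n"
  define t where "t i = a + real i * w" for i
  have w: "0 < w" "w < d" using ab n n0 assms by (simp_all add: w_def field_simps)
  have "t (Suc i) - t i = w" for i by (simp add: t_def algebra_simps)
  moreover have "t 0 = a" "t n = b" using n0 by (simp_all add: t_def w_def)
  ultimately show ?thesis
    using w unfolding is_partition_def by (metis diff_gt_0_iff_gt)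
qed

lemma has_young_integral_unique:
  assumes "a \<le> b" and I: "has_young_integral a b x y I" and J: "has_young_integral a b x y J"
  shows "I = J"
proof (rule ccontr)
  assume "I \<noteq> J"
  define e where "e = norm (I - J) / 2"
  have "e > 0" using \<open>I \<noteq> J\<close> by (simp add: e_def)
  obtain d1 where d1: "d1 > 0"
    "\<forall>n t s. is_partition a b n t \<and> (\<forall>i<n. t (Suc i) - t i < d1) \<and> (\<forall>i<n. s i \<in> {t i..t (Suc i)}) \<longrightarrow>
      norm ((\<Sum>i<n. x (s i) * (y (t (Suc i)) - y (t i))) - I) < e"
    using I [unfolded has_young_integral_def, THEN spec, THEN mp, OF \<open>e > 0\<close>]
    by (elim exE conjE)
  obtain d2 where d2: "d2 > 0"
    "\<forall>n t s. is_partition a b n t \<and> (\<forall>i<n. t (Suc i) - t i < d2) \<and> (\<forall>i<n. s i \<in> {t i..t (Suc i)}) \<longrightarrow>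
      norm ((\<Sum>i<n. x (s i) * (y (t (Suc i)) - y (t i))) - J) < e"
    using J [unfolded has_young_integral_def, THEN spec, THEN mp, OF \<open>e > 0\<close>]
    by (elim exE conjE)
  obtain n t where t: "is_partition a b n t" "\<forall>i<n. t (Suc i) - t i < min d1 d2"
    using fine_partition_exists [OF \<open>a \<le> b\<close>, of "min d1 d2"] d1(1) d2(1) by auto
  have s: "\<forall>i<n. t i \<in> {t i..t (Suc i)}" using t(1) by (auto simp: is_partition_def less_imp_le)
  let ?S = "\<Sum>i<n. x (t i) * (y (t (Suc i)) - y (t i))"
  have "norm (?S - I) < e" "norm (?S - J) < e"
    using d1(2) [THEN spec, THEN spec, THEN spec, THEN mp, of n t t]
      d2(2) [THEN spec, THEN spec, THEN spec, THEN mp, of n t t] t s by simp_all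
  then have "norm (I - J) < 2 * e"
    using norm_triangle_ineq4 [of "?S - J" "?S - I"] by simp
  then show False by (simp add: e_def)
qed

section \<open>The trilinear map and the quantity \<open>M\<close>\<close>

definition complex_linear_on :: "('a \<Rightarrow> complex) set \<Rightarrow> (('a \<Rightarrow> complex) \<Rightarrow> complex) \<Rightarrow> bool" where
  "complex_linear_on X \<phi> \<longleftrightarrow>
     (\<forall>u\<in>X. \<forall>v\<in>X. \<phi> (\<lambda>z. u z + v z) = \<phi> u + \<phi> v) \<and>
     (\<forall>c. \<forall>u\<in>X. \<phi> (\<lambda>z. c * u z) = c * \<phi> u)"

definition complex_trilinear_on ::
  "('a \<Rightarrow> complex) set \<Rightarrow> ('b \<Rightarrow> complex) set \<Rightarrow> ('c \<Rightarrow> complex) set \<Rightarrow>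
   (('a \<Rightarrow> complex) \<Rightarrow> ('b \<Rightarrow> complex) \<Rightarrow> ('c \<Rightarrow> complex) \<Rightarrow> complex) \<Rightarrow> bool" where
  "complex_trilinear_on X Y Z \<Phi> \<longleftrightarrow>
     (\<forall>v\<in>Y. \<forall>w\<in>Z. complex_linear_on X (\<lambda>u. \<Phi> u v w)) \<and>
     (\<forall>u\<in>X. \<forall>w\<in>Z. complex_linear_on Y (\<lambda>v. \<Phi> u v w)) \<and>
     (\<forall>u\<in>X. \<forall>v\<in>Y. complex_linear_on Z (\<lambda>w. \<Phi> u v w))"

definition path_integrand ::
  "(real \<Rightarrow> 'v) \<Rightarrow> ('v \<Rightarrow> complex) \<Rightarrow> (complex \<Rightarrow> complex) \<Rightarrow> (complex \<Rightarrow> complex) \<Rightarrow>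
   ('v \<Rightarrow> complex) \<Rightarrow> real \<Rightarrow> complex" where
  "path_integrand \<gamma> f L E g = (\<lambda>x. (E \<circ> L \<circ> f) x * g x) \<circ> \<gamma>"

definition I_map ::
  "real \<Rightarrow> (real \<Rightarrow> 'v) \<Rightarrow> ('v \<Rightarrow> complex) \<Rightarrow> (complex \<Rightarrow> complex) \<Rightarrow> (complex \<Rightarrow> complex) \<Rightarrow>
   ('v \<Rightarrow> complex) \<Rightarrow> ('v \<Rightarrow> complex) \<Rightarrow> complex" where
  "I_map T \<gamma> f L E g h = young_integral 0 T (path_integrand \<gamma> f L E g) (h \<circ> \<gamma>)"

text \<open>The suprema below are maxima, since \<open>S\<close> will be compact and nonempty.\<close>

definition M_bound ::
  "'v::metric_space set \<Rightarrow> (complex \<Rightarrow> complex) \<Rightarrow> (complex \<Rightarrow> complex) \<Rightarrow>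
   ('v \<Rightarrow> complex) \<Rightarrow> ('v \<Rightarrow> complex) \<Rightarrow> real" where
  "M_bound S L E f g =
     Lip_seminorm S g * (SUP z\<in>f ` S. norm (E (L z))) +
     Lip_seminorm S f * (SUP x\<in>S. norm (g x)) *
       (SUP z\<in>convex hull (f ` S). norm (deriv E (log_hull (f ` S) L z))) /
       infdist 0 (convex hull (f ` S))"

end

theory Submission
  imports Defs "HOL-Complex_Analysis.Cauchy_Integral_Formula"
begin

text \<open>The increments of \<open>\<gamma>\<close> are bounded by \<open>w s t powr (1 / p)\<close>, where \<open>w s t\<close> is the \<open>p\<close>-th power of
  the \<open>p\<close>-variation of \<open>\<gamma>\<close> on the interval from \<open>s\<close> to \<open>t\<close>, a superadditive function of the interval
  (\<open>variation_control\<close>). Composing with Lipschitz functions preserves such bounds, so integrand and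
  integrator are both controlled by \<open>w\<close> with exponent \<open>1 / p > 1 / 2\<close>, with constants \<open>A\<close> and
  \<open>B\<close> that are Lipschitz constants on \<open>S\<close>.

  Such pairs satisfy the Young-Loeve estimate: a left-point sum differs from the product of the
  initial value and the total increment over an interval from \<open>a\<close> to \<open>b\<close> by at most
  \<open>A * B * w a b powr (2 / p) / (1 - 2 powr (1 - 2 / p))\<close>, independently of the partition
  (\<open>discrete_young_loeve\<close>). The constant comes from cutting the index interval into two parts
  of at most half the control, separated by a single step. In the limit this gives the bound on the
  integral (\<open>young_integral_bound\<close>). Applied to the blocks of a refinement, at an exponent slightly
  below \<open>1 / p\<close>, it also gives convergence of the sums (\<open>young_integral_exists\<close>): the power of the
  increment that is left over tends to \<open>0\<close> with the mesh by continuity. Trilinearity is then linearity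
  of limits.

  What remains is that \<open>M_bound\<close> is a Lipschitz constant of the integrand
  (\<open>integrand_lipschitz\<close>). This is the product rule, together with the mean value inequality for
  \<open>E \<circ> log\<close> on the convex hull of \<open>f ` S\<close>, where the derivative is \<open>E' (log z) / z\<close>
  (\<open>entire_log_lipschitz\<close>).\<close>

section \<open>The Young-Loeve estimate for finite sums\<close>

text \<open>The arithmetic-geometric mean inequality gives \<open>(a * b) powr \<alpha> \<le> (w / 2) powr (2 * \<alpha>)\<close>, and
  \<open>\<alpha> > 1 / 2\<close> turns the factor \<open>2 powr (- 2 * \<alpha>)\<close> into at most \<open>1 / 2\<close>. The gain of this
  \<open>1 / 2\<close> is what allows an interval to be cut at two points, rather than one, at the cost of a
  single \<open>w powr (2 * \<alpha>)\<close>.\<close>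

lemma powr_product_half:
  fixes a b w \<alpha> :: real
  assumes "0 \<le> a" "0 \<le> b" "a + b \<le> w" "1 / 2 < \<alpha>"
  shows "a powr \<alpha> * b powr \<alpha> \<le> w powr (2 * \<alpha>) / 2"
proof -
  have "a * b \<le> (w / 2) ^ 2"
  proof -
    have "4 * (a * b) \<le> (a + b) ^ 2"
      using zero_le_power2 [of "a - b"] by (simp add: power2_eq_square algebra_simps)
    also have "\<dots> \<le> w ^ 2" using assms by (intro power_mono) auto
    finally show ?thesis by (simp add: power_divide)
  qed
  then have "(a * b) powr \<alpha> \<le> ((w / 2) ^ 2) powr \<alpha>"
    using assms by (intro powr_mono2) auto
  also have "((w / 2) ^ 2) powr \<alpha> = (w / 2) powr (2 * \<alpha>)"
    using assms by (simp add: powr_powr flip: powr_numeral)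
  also have "\<dots> = w powr (2 * \<alpha>) / 2 powr (2 * \<alpha>)"
    using assms by (simp add: powr_divide)
  also have "\<dots> \<le> w powr (2 * \<alpha>) / 2"
  proof -
    have "2 powr 1 \<le> (2::real) powr (2 * \<alpha>)" using assms by (intro powr_mono) auto
    then show ?thesis by (intro divide_left_mono) auto
  qed
  finally show ?thesis using assms by (simp add: powr_mult)
qed

text \<open>For paths controlled with exponent \<open>\<alpha> = 1 / p\<close>, this is the constant
  \<open>1 / (1 - 2 powr (1 - 2 / p))\<close> of the theorem. It is the sum of the geometric series with ratio
  \<open>2 powr (1 - 2 * \<alpha>)\<close>, the factor by which the error bound shrinks when an interval is replaced by
  two intervals of half the control.\<close>

definition young_const :: "real \<Rightarrow> real" where
  "young_const \<alpha> = 1 / (1 - 2 powr (1 - 2 * \<alpha>))"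

lemma young_const_fixed_point:
  assumes "1 / 2 < \<alpha>"
  shows "0 < young_const \<alpha>" and "1 + young_const \<alpha> * 2 powr (1 - 2 * \<alpha>) = young_const \<alpha>"
proof -
  have "2 powr (1 - 2 * \<alpha>) < (2::real) powr 0" using assms by (intro powr_less_mono) auto
  then have l: "2 powr (1 - 2 * \<alpha>) < (1::real)" by simp
  then show "0 < young_const \<alpha>" by (simp add: young_const_def)
  show "1 + young_const \<alpha> * 2 powr (1 - 2 * \<alpha>) = young_const \<alpha>"
    using l unfolding young_const_def
    by (metis add_divide_distrib diff_add_cancel diff_gt_0_iff_gt divide_self less_irrefl
        mult.left_neutral times_divide_eq_left)
qed

text \<open>The Young-Loeve estimate for finite sums. With the control \<open>w i j\<close> of the whole index interval
  written \<open>W\<close>, let \<open>k\<close> be the last index before \<open>j\<close> with \<open>w i k \<le> W / 2\<close>. By superadditivity the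
  interval from \<open>Suc k\<close> to \<open>j\<close> also has control at most \<open>W / 2\<close>, while the single step from \<open>k\<close> to
  \<open>Suc k\<close>, whose control may be large, contributes no error of its own. Cutting at \<open>k\<close> and at \<open>Suc k\<close>
  costs two products of increments over adjacent intervals, each at most
  \<open>A * B * W powr (2 * \<alpha>) / 2\<close>; the two halves together contribute by induction
  \<open>2 powr (1 - 2 * \<alpha>)\<close> times the claimed bound. The claimed constant is the fixed point of this
  recursion.\<close>

lemma discrete_young_loeve:
  fixes x y :: "nat \<Rightarrow> complex" and w :: "nat \<Rightarrow> nat \<Rightarrow> real"
  assumes \<alpha>: "1 / 2 < \<alpha>" and AB: "0 \<le> A" "0 \<le> B"
    and w0: "\<And>i j. m \<le> i \<Longrightarrow> i \<le> j \<Longrightarrow> j \<le> n \<Longrightarrow> 0 \<le> w i j"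
    and ws: "\<And>i j k. m \<le> i \<Longrightarrow> i \<le> j \<Longrightarrow> j \<le> k \<Longrightarrow> k \<le> n \<Longrightarrow> w i j + w j k \<le> w i k"
    and x: "\<And>i j. m \<le> i \<Longrightarrow> i \<le> j \<Longrightarrow> j \<le> n \<Longrightarrow> norm (x j - x i) \<le> A * w i j powr \<alpha>"
    and y: "\<And>i j. m \<le> i \<Longrightarrow> i \<le> j \<Longrightarrow> j \<le> n \<Longrightarrow> norm (y j - y i) \<le> B * w i j powr \<alpha>"
    and ij: "m \<le> i" "i \<le> j" "j \<le> n"
  shows "norm ((\<Sum>l = i..<j. x l * (y (Suc l) - y l)) - x i * (y j - y i))
           \<le> A * B * young_const \<alpha> * w i j powr (2 * \<alpha>)"
  using ij
proof (induction "j - i" arbitrary: i j rule: less_induct)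
  case less
  let ?C = "young_const \<alpha>"
  let ?err = "\<lambda>i j. (\<Sum>l = i..<j. x l * (y (Suc l) - y l)) - x i * (y j - y i)"
  note C = young_const_fixed_point [OF \<alpha>]
  show ?case
  proof (cases "i = j")
    case True
    then show ?thesis using AB C(1) by simp
  next
    case False
    with less.prems have ij: "i < j" by simp
    have w_refl: "w l l = 0" if "m \<le> l" "l \<le> n" for l
      using w0 [of l l] ws [of l l l] that by simp
    \<comment> \<open>The bound \<open>k < j\<close> guarantees that the middle step from \<open>k\<close> to \<open>Suc k\<close> exists; \<open>Suc k = j\<close> is
      possible and then the right part is empty.\<close>
    define k where "k = Max {l \<in> {i..<j}. w i l \<le> w i j / 2}"
    have fin: "finite {l \<in> {i..<j}. w i l \<le> w i j / 2}" by simp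
    have "i \<in> {l \<in> {i..<j}. w i l \<le> w i j / 2}"
      using ij less.prems w_refl [of i] w0 [of i j] by simp
    then have "k \<in> {l \<in> {i..<j}. w i l \<le> w i j / 2}"
      unfolding k_def using Max_in [OF fin] by blast
    then have k: "i \<le> k" "k < j" "w i k \<le> w i j / 2" by auto
    have right: "w (Suc k) j \<le> w i j / 2"
    proof (cases "Suc k = j")
      case True
      then show ?thesis using w_refl [of j] w0 [of i j] less.prems by simp
    next
      case False
      with k have "\<not> w i (Suc k) \<le> w i j / 2"
        using Max_ge [OF fin, of "Suc k"] unfolding k_def [symmetric] by auto
      then show ?thesis using ws [of i "Suc k" j] k less.prems by simp
    qed
    \<comment> \<open>The last two products are the costs of cutting at \<open>k\<close> and of cutting the remainder at \<open>Suc k\<close>.\<close>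
    have split: "?err i j = ?err i k + ?err (Suc k) j
      + (x k - x i) * (y j - y k) + (x (Suc k) - x k) * (y j - y (Suc k))"
    proof -
      have "(\<Sum>l = i..<j. x l * (y (Suc l) - y l))
          = (\<Sum>l = i..<k. x l * (y (Suc l) - y l)) + (\<Sum>l = k..<j. x l * (y (Suc l) - y l))"
        using k by (subst sum.atLeastLessThan_concat) auto
      also have "(\<Sum>l = k..<j. x l * (y (Suc l) - y l))
          = x k * (y (Suc k) - y k) + (\<Sum>l = Suc k..<j. x l * (y (Suc l) - y l))"
        using k by (simp add: sum.atLeast_Suc_lessThan)
      finally show ?thesis by (simp add: algebra_simps)
    qed
    let ?W = "w i j powr (2 * \<alpha>)"
    have n1: "norm (?err i k) \<le> A * B * ?C * w i k powr (2 * \<alpha>)"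
      using less.hyps [of k i] k less.prems by simp
    have n2: "norm (?err (Suc k) j) \<le> A * B * ?C * w (Suc k) j powr (2 * \<alpha>)"
      using less.hyps [of j "Suc k"] k less.prems by simp
    have n3: "norm ((x k - x i) * (y j - y k)) \<le> A * B * (?W / 2)"
    proof -
      have "norm ((x k - x i) * (y j - y k))
          \<le> (A * w i k powr \<alpha>) * (B * w k j powr \<alpha>)"
        unfolding norm_mult using k less.prems AB by (intro mult_mono x y) auto
      also have "\<dots> = A * B * (w i k powr \<alpha> * w k j powr \<alpha>)" by simp
      also have "\<dots> \<le> A * B * (?W / 2)"
        using k less.prems AB \<alpha>
        by (intro mult_left_mono powr_product_half w0 ws) auto
      finally show ?thesis .
    qed
    have n4: "norm ((x (Suc k) - x k) * (y j - y (Suc k))) \<le> A * B * (?W / 2)"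
    proof -
      have "norm ((x (Suc k) - x k) * (y j - y (Suc k)))
          \<le> (A * w k (Suc k) powr \<alpha>) * (B * w (Suc k) j powr \<alpha>)"
        unfolding norm_mult using k less.prems AB by (intro mult_mono x y) auto
      also have "\<dots> = A * B * (w k (Suc k) powr \<alpha> * w (Suc k) j powr \<alpha>)" by simp
      also have "\<dots> \<le> A * B * (?W / 2)"
      proof (intro mult_left_mono powr_product_half)
        show "w k (Suc k) + w (Suc k) j \<le> w i j"
          using ws [of k "Suc k" j] ws [of i k j] w0 [of i k] k less.prems by simp
      qed (use k less.prems AB \<alpha> w0 in auto)
      finally show ?thesis .
    qed
    have halves: "w i k powr (2 * \<alpha>) + w (Suc k) j powr (2 * \<alpha>) \<le> 2 powr (1 - 2 * \<alpha>) * ?W"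
    proof -
      have half: "v powr (2 * \<alpha>) \<le> ?W / 2 powr (2 * \<alpha>)" if "0 \<le> v" "v \<le> w i j / 2" for v
      proof -
        have "v powr (2 * \<alpha>) \<le> (w i j / 2) powr (2 * \<alpha>)"
          using that \<alpha> by (intro powr_mono2) auto
        then show ?thesis using that by (simp add: powr_divide)
      qed
      have "w i k powr (2 * \<alpha>) \<le> ?W / 2 powr (2 * \<alpha>)"
        "w (Suc k) j powr (2 * \<alpha>) \<le> ?W / 2 powr (2 * \<alpha>)"
        using k right less.prems by (auto intro!: half w0)
      then show ?thesis by (simp add: powr_diff)
    qed
    have "norm (?err i j) \<le> norm (?err i k) + norm (?err (Suc k) j)
        + norm ((x k - x i) * (y j - y k)) + norm ((x (Suc k) - x k) * (y j - y (Suc k)))"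
      unfolding split by (intro norm_triangle_le add_mono order_refl)
    also have "\<dots> \<le> A * B * ?C * (w i k powr (2 * \<alpha>) + w (Suc k) j powr (2 * \<alpha>)) + A * B * ?W"
      using n1 n2 n3 n4 by (simp add: distrib_left)
    also have "\<dots> \<le> A * B * ?C * (2 powr (1 - 2 * \<alpha>) * ?W) + A * B * ?W"
      using halves AB C(1) by (intro add_right_mono mult_left_mono) auto
    also have "\<dots> = A * B * (1 + ?C * 2 powr (1 - 2 * \<alpha>)) * ?W" by (simp add: algebra_simps)
    finally show ?thesis by (simp only: C(2))
  qed
qed

section \<open>Controls and the variation of a path\<close>

text \<open>Superadditive interval functions, called controls in rough path theory. Such a function vanishes
  on the diagonal because \<open>w s s + w s s \<le> w s s\<close>.\<close>

definition control_on :: "real \<Rightarrow> real \<Rightarrow> (real \<Rightarrow> real \<Rightarrow> real) \<Rightarrow> bool" where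
  "control_on a b w \<longleftrightarrow>
     (\<forall>s t. a \<le> s \<and> s \<le> t \<and> t \<le> b \<longrightarrow> 0 \<le> w s t) \<and>
     (\<forall>r s t. a \<le> r \<and> r \<le> s \<and> s \<le> t \<and> t \<le> b \<longrightarrow> w r s + w s t \<le> w r t)"

lemma control_mono:
  assumes "control_on a b w" "a \<le> r" "r \<le> s" "s \<le> t" "t \<le> v" "v \<le> b"
  shows "0 \<le> w s t" "w s t \<le> w r v"
proof -
  have "0 \<le> w s t" "0 \<le> w r s" "0 \<le> w t v" "w r s + w s t \<le> w r t" "w r t + w t v \<le> w r v"
    using assms by (auto simp: control_on_def)
  then show "0 \<le> w s t" "w s t \<le> w r v" by linarith+
qed

lemma is_partition_less:
  assumes "is_partition a b n t" "i < j" "j \<le> n"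
  shows "t i < t j"
  using assms(2,3)
proof (induction j)
  case (Suc j)
  have "t j < t (Suc j)" using assms(1) Suc.prems by (simp add: is_partition_def)
  moreover have "t i \<le> t j" using Suc by (cases "i = j") auto
  ultimately show ?case by simp
qed simp

lemma is_partition_le:
  assumes "is_partition a b n t" "i \<le> j" "j \<le> n"
  shows "t i \<le> t j"
  using is_partition_less [OF assms(1), of i j] assms by (cases "i = j") auto

lemma is_partition_bounds:
  assumes "is_partition a b n t" "i \<le> n"
  shows "a \<le> t i" "t i \<le> b"
  using is_partition_le [OF assms(1), of 0 i] is_partition_le [OF assms(1), of i n] assms
  by (auto simp: is_partition_def)

lemma control_partition_sum:
  assumes w: "control_on a b w" and t: "is_partition a b n t" and "j \<le> n"
  shows "(\<Sum>i<j. w (t i) (t (Suc i))) \<le> w a (t j)"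
  using \<open>j \<le> n\<close>
proof (induction j)
  case 0
  then show ?case using w is_partition_bounds [OF t, of 0] t
    by (simp add: control_on_def is_partition_def)
next
  case (Suc j)
  have "w a (t j) + w (t j) (t (Suc j)) \<le> w a (t (Suc j))"
    using w is_partition_bounds [OF t, of j] is_partition_bounds [OF t, of "Suc j"]
      is_partition_le [OF t, of j "Suc j"] Suc.prems
    by (simp add: control_on_def)
  then show ?case using Suc by simp
qed

text \<open>An exponent above \<open>1\<close> leaves a factor \<open>w a b powr (\<theta> - 1)\<close> on each term once the superadditive sum
  is split off.\<close>

lemma control_partition_powr_sum:
  assumes w: "control_on a b w" and t: "is_partition a b n t" and \<theta>: "1 < \<theta>"
  shows "(\<Sum>i<n. w (t i) (t (Suc i)) powr \<theta>) \<le> w a b powr \<theta>"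
proof -
  have ab: "a \<le> b" using is_partition_bounds [OF t, of 0] t by (simp add: is_partition_def)
  have b: "0 \<le> w (t i) (t (Suc i))" "w (t i) (t (Suc i)) \<le> w a b" if "i < n" for i
    using control_mono [OF w, of a "t i" "t (Suc i)" b] that
      is_partition_bounds [OF t, of i] is_partition_bounds [OF t, of "Suc i"]
      is_partition_le [OF t, of i "Suc i"] by auto
  have "(\<Sum>i<n. w (t i) (t (Suc i)) powr \<theta>)
      \<le> (\<Sum>i<n. w (t i) (t (Suc i)) * w a b powr (\<theta> - 1))"
  proof (intro sum_mono)
    fix i assume "i \<in> {..<n}"
    then have i: "i < n" by simp
    have "w (t i) (t (Suc i)) powr \<theta> = w (t i) (t (Suc i)) powr (1 + (\<theta> - 1))" by simp
    also have "\<dots> = w (t i) (t (Suc i)) * w (t i) (t (Suc i)) powr (\<theta> - 1)"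
      unfolding powr_add using b [OF i] by simp
    also have "\<dots> \<le> w (t i) (t (Suc i)) * w a b powr (\<theta> - 1)"
      using b [OF i] \<theta> by (intro mult_left_mono powr_mono2) auto
    finally show "w (t i) (t (Suc i)) powr \<theta> \<le> w (t i) (t (Suc i)) * w a b powr (\<theta> - 1)" .
  qed
  also have "\<dots> = (\<Sum>i<n. w (t i) (t (Suc i))) * w a b powr (\<theta> - 1)"
    by (simp add: sum_distrib_right)
  also have "\<dots> \<le> w a b * w a b powr (\<theta> - 1)"
    using control_partition_sum [OF w t, of n] t
    by (intro mult_right_mono) (auto simp: is_partition_def)
  also have "\<dots> = w a b powr (1 + (\<theta> - 1))"
    unfolding powr_add using control_mono [OF w, of a a b b] ab by simp
  finally show ?thesis by simp
qed

lemma variation_sums_concat: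
  assumes "u \<in> variation_sums p a b \<gamma>" "v \<in> variation_sums p b c \<gamma>"
  shows "u + v \<in> variation_sums p a c \<gamma>"
proof -
  obtain n t where t: "is_partition a b n t"
    and u: "u = (\<Sum>i<n. norm (\<gamma> (t (Suc i)) - \<gamma> (t i)) powr p)"
    using assms(1) by (auto simp: variation_sums_def)
  obtain m s where s: "is_partition b c m s"
    and v: "v = (\<Sum>i<m. norm (\<gamma> (s (Suc i)) - \<gamma> (s i)) powr p)"
    using assms(2) by (auto simp: variation_sums_def)
  define r where "r i = (if i \<le> n then t i else s (i - n))" for i
  have r1: "r i = t i" if "i \<le> n" for i using that by (simp add: r_def)
  have r2: "r (n + i) = s i" for i
    using t s by (cases "i = 0") (auto simp: r_def is_partition_def)
  have "is_partition a c (n + m) r"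
    unfolding is_partition_def
  proof (intro conjI allI impI)
    show "r 0 = a" using r1 [of 0] t by (simp add: is_partition_def)
    show "r (n + m) = c" using r2 [of m] s by (simp add: is_partition_def)
    fix i assume i: "i < n + m"
    show "r i < r (Suc i)"
    proof (cases "i < n")
      case True
      then show ?thesis using r1 [of i] r1 [of "Suc i"] t by (simp add: is_partition_def)
    next
      case False
      then show ?thesis
        using r2 [of "i - n"] r2 [of "Suc (i - n)"] s i by (simp add: is_partition_def)
    qed
  qed
  moreover have "(\<Sum>i<n + m. norm (\<gamma> (r (Suc i)) - \<gamma> (r i)) powr p) = u + v"
  proof -
    have "(\<Sum>i<n + m. norm (\<gamma> (r (Suc i)) - \<gamma> (r i)) powr p)
        = (\<Sum>i<n. norm (\<gamma> (r (Suc i)) - \<gamma> (r i)) powr p)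
          + (\<Sum>i<m. norm (\<gamma> (r (Suc (n + i))) - \<gamma> (r (n + i))) powr p)"
      by (induction m) (simp_all add: add.assoc)
    moreover have "(\<Sum>i<n. norm (\<gamma> (r (Suc i)) - \<gamma> (r i)) powr p) = u"
      unfolding u by (intro sum.cong) (auto simp: r1)
    moreover have "(\<Sum>i<m. norm (\<gamma> (r (Suc (n + i))) - \<gamma> (r (n + i))) powr p) = v"
      unfolding v using r2 by (intro sum.cong) (auto simp flip: add_Suc_right)
    ultimately show ?thesis by simp
  qed
  ultimately show ?thesis by (auto simp: variation_sums_def intro!: exI [of _ "n + m"] exI [of _ r])
qed

lemma variation_sums_increment:
  assumes "a \<le> b" and "0 < p"
  shows "norm (\<gamma> b - \<gamma> a) powr p \<in> variation_sums p a b \<gamma>"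
proof (cases "a = b")
  case True
  \<comment> \<open>Partitions are strictly increasing, so a degenerate interval only has the one without steps.\<close>
  then show ?thesis using assms
    by (auto simp: variation_sums_def is_partition_def intro!: exI [of _ 0] exI [of _ "\<lambda>_. a"])
next
  case False
  then show ?thesis using assms
    by (auto simp: variation_sums_def is_partition_def
        intro!: exI [of _ "Suc 0"] exI [of _ "\<lambda>i. if i = 0 then a else b"])
qed

lemma finite_p_variation_subinterval:
  assumes "finite_p_variation p a b \<gamma>" "0 < p" "a \<le> s" "s \<le> t" "t \<le> b"
  shows "finite_p_variation p s t \<gamma>"
proof -
  obtain K where K: "\<And>v. v \<in> variation_sums p a b \<gamma> \<Longrightarrow> v \<le> K"
    using assms(1) by (auto simp: finite_p_variation_def bdd_above_def)
  have "v \<le> K" if v: "v \<in> variation_sums p s t \<gamma>" for v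
  proof -
    have "norm (\<gamma> s - \<gamma> a) powr p + v + norm (\<gamma> b - \<gamma> t) powr p \<in> variation_sums p a b \<gamma>"
      using assms
      by (intro variation_sums_concat [where b = t] variation_sums_concat [where b = s]
          variation_sums_increment v) auto
    then have "norm (\<gamma> s - \<gamma> a) powr p + v + norm (\<gamma> b - \<gamma> t) powr p \<le> K" by (rule K)
    moreover have "0 \<le> norm (\<gamma> s - \<gamma> a) powr p" "0 \<le> norm (\<gamma> b - \<gamma> t) powr p" by simp_all
    ultimately show ?thesis by linarith
  qed
  then show ?thesis by (auto simp: finite_p_variation_def bdd_above_def)
qed

text \<open>The \<open>p\<close>-th power of the \<open>p\<close>-variation is superadditive because partitions of adjacent intervals can
  be concatenated; the trivial partition of an interval bounds the increment over it.\<close>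

lemma variation_control:
  assumes \<gamma>: "finite_p_variation p a b \<gamma>" and p: "0 < p"
  shows "control_on a b (\<lambda>s t. Sup (variation_sums p s t \<gamma>))"
    and "\<lbrakk>a \<le> s; s \<le> t; t \<le> b\<rbrakk> \<Longrightarrow>
           norm (\<gamma> t - \<gamma> s) \<le> Sup (variation_sums p s t \<gamma>) powr (1 / p)"
proof -
  let ?V = "\<lambda>s t. variation_sums p s t \<gamma>"
  have bdd: "bdd_above (?V s t)" if "a \<le> s" "s \<le> t" "t \<le> b" for s t
    using finite_p_variation_subinterval [OF \<gamma> p that] by (simp add: finite_p_variation_def)
  have ne: "?V s t \<noteq> {}" if "s \<le> t" for s t
    using variation_sums_increment [OF that p] by blast
  have inc: "norm (\<gamma> t - \<gamma> s) powr p \<le> Sup (?V s t)" if "a \<le> s" "s \<le> t" "t \<le> b" for s t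
    by (intro cSup_upper variation_sums_increment bdd that p)
  show "control_on a b (\<lambda>s t. Sup (?V s t))"
    unfolding control_on_def
  proof (intro conjI allI impI)
    fix s t assume "a \<le> s \<and> s \<le> t \<and> t \<le> b"
    then show "0 \<le> Sup (?V s t)" using inc [of s t] by (meson order_trans powr_ge_zero)
  next
    fix r s t assume rst: "a \<le> r \<and> r \<le> s \<and> s \<le> t \<and> t \<le> b"
    have "u \<le> Sup (?V r t) - Sup (?V s t)" if u: "u \<in> ?V r s" for u
    proof -
      have "Sup (?V s t) \<le> Sup (?V r t) - u"
      proof (intro cSup_least ne)
        fix v assume "v \<in> ?V s t"
        then have "u + v \<le> Sup (?V r t)"
          using rst by (intro cSup_upper variation_sums_concat [OF u] bdd) auto
        then show "v \<le> Sup (?V r t) - u" by simp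
      qed (use rst in auto)
      then show ?thesis by simp
    qed
    then have "Sup (?V r s) \<le> Sup (?V r t) - Sup (?V s t)"
      using rst by (intro cSup_least ne) auto
    then show "Sup (?V r s) + Sup (?V s t) \<le> Sup (?V r t)" by simp
  qed
  assume st: "a \<le> s" "s \<le> t" "t \<le> b"
  have "(norm (\<gamma> t - \<gamma> s) powr p) powr (1 / p) \<le> Sup (?V s t) powr (1 / p)"
    using inc [OF st] p by (intro powr_mono2) auto
  then show "norm (\<gamma> t - \<gamma> s) \<le> Sup (?V s t) powr (1 / p)"
    using p by (simp add: powr_powr)
qed

section \<open>Refinements of partitions\<close>

text \<open>Finite sets are easier to merge than increasing sequences: the common refinement of two
  partitions is the partition enumerating the union of their points.\<close>

lemma partition_of_finite_set:
  assumes U: "finite U" "a \<in> U" "b \<in> U" "U \<subseteq> {a..b}"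
  shows "\<exists>m u. is_partition a b m u \<and> u ` {..m} = U"
proof -
  define l where "l = sorted_list_of_set U"
  have l: "set l = U" "sorted_wrt (<) l"
    using U(1) by (simp_all add: l_def)
  have less: "l ! i < l ! j" if "i < j" "j < length l" for i j
    using sorted_wrt_nth_less [OF l(2) that] .
  have len: "0 < length l" using l(1) U(2) by (cases l) auto
  define m where "m = length l - 1"
  have range: "a \<le> l ! i" "l ! i \<le> b" if "i \<le> m" for i
  proof -
    have "l ! i \<in> set l" using that len unfolding m_def by (intro nth_mem) linarith
    then show "a \<le> l ! i" "l ! i \<le> b" using l(1) U(4) by auto
  qed
  have "l ! 0 = a"
  proof -
    have "a \<in> set l" using U(2) l(1) by simp
    then obtain i where "i < length l" and i: "l ! i = a" unfolding in_set_conv_nth by blast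
    then have "i \<le> m" by (simp add: m_def)
    then show ?thesis using less [of 0 i] range [of 0] \<open>i < length l\<close> i by (cases "i = 0") auto
  qed
  moreover have "l ! m = b"
  proof -
    have "b \<in> set l" using U(3) l(1) by simp
    then obtain i where "i < length l" and i: "l ! i = b" unfolding in_set_conv_nth by blast
    then have "i \<le> m" by (simp add: m_def)
    then show ?thesis using less [of i m] range [of m] len i by (cases "i = m") (auto simp: m_def)
  qed
  moreover have "(!) l ` {..m} = U"
  proof -
    have "i \<le> m \<longleftrightarrow> i < length l" for i using len unfolding m_def by linarith
    then have "{..m} = {i. i < length l}" by auto
    then show ?thesis unfolding l(1) [symmetric] set_conv_nth by auto
  qed
  moreover have "l ! i < l ! Suc i" if "i < m" for i using that by (intro less) (auto simp: m_def)
  ultimately show ?thesis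
    by (intro exI [of _ m] exI [of _ "(!) l"]) (simp add: is_partition_def)
qed

lemma refinement_index_map:
  assumes t: "is_partition a b n t" and u: "is_partition a b m u" and sub: "t ` {..n} \<subseteq> u ` {..m}"
  obtains k where "k 0 = 0" "k n = m" "\<And>i. i \<le> n \<Longrightarrow> k i \<le> m \<and> u (k i) = t i"
    "\<And>i. i < n \<Longrightarrow> k i \<le> k (Suc i)"
proof -
  have "\<forall>i. \<exists>j. i \<le> n \<longrightarrow> j \<le> m \<and> u j = t i" using sub by (fastforce simp: image_def subset_iff)
  then obtain k where k: "\<And>i. i \<le> n \<Longrightarrow> k i \<le> m \<and> u (k i) = t i" by metis
  have inj: "i = j" if "u i = u j" "i \<le> m" "j \<le> m" for i j
    using that is_partition_less [OF u, of i j] is_partition_less [OF u, of j i]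
    by (cases i j rule: linorder_cases) auto
  show ?thesis
  proof (rule that [of k, OF _ _ k])
    show "k 0 = 0" using k [of 0] t u by (intro inj) (auto simp: is_partition_def)
    show "k n = m" using k [of n] t u by (intro inj) (auto simp: is_partition_def)
    fix i assume i: "i < n"
    have "t i < t (Suc i)" using t i by (simp add: is_partition_def)
    then show "k i \<le> k (Suc i)"
      using k [of i] k [of "Suc i"] i is_partition_less [OF u, of "k (Suc i)" "k i"]
      by (cases "k i \<le> k (Suc i)") auto
  qed auto
qed

lemma sum_over_blocks:
  fixes F :: "nat \<Rightarrow> 'a::comm_monoid_add"
  assumes "k 0 = 0" "\<And>i. i < n \<Longrightarrow> k i \<le> k (Suc i)"
  shows "(\<Sum>l<k n. F l) = (\<Sum>i<n. \<Sum>l = k i..<k (Suc i). F l)"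
  using assms(2)
proof (induction n)
  case 0
  then show ?case using assms(1) by simp
next
  case (Suc n)
  have "(\<Sum>l<k (Suc n). F l) = (\<Sum>l<k n. F l) + (\<Sum>l = k n..<k (Suc n). F l)"
    using Suc.prems [of n] by (simp add: lessThan_atLeast0 sum.atLeastLessThan_concat)
  then show ?case using Suc by simp
qed

text \<open>Passing from a tagged sum to the left-point sum of a refinement changes each block by the
  discrete error of that block and by the product coming from moving the tag to the left end; both
  are powers \<open>2 * \<alpha> > 1\<close> of the control of the block, so their sum over the blocks is at most the same power of \<open>w a b\<close>. The bound on \<open>y\<close> is
  only required at distances below the mesh \<open>d\<close>, so that its constant \<open>B\<close> may tend to \<open>0\<close> with \<open>d\<close>.\<close>

lemma tagged_sum_refinement:
  fixes x y :: "real \<Rightarrow> complex"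
  assumes \<alpha>: "1 / 2 < \<alpha>" and AB: "0 \<le> A" "0 \<le> B" and w: "control_on a b w"
    and x: "\<And>s t. a \<le> s \<Longrightarrow> s \<le> t \<Longrightarrow> t \<le> b \<Longrightarrow> norm (x t - x s) \<le> A * w s t powr \<alpha>"
    and y: "\<And>s t. a \<le> s \<Longrightarrow> s \<le> t \<Longrightarrow> t \<le> b \<Longrightarrow> t - s < d \<Longrightarrow>
              norm (y t - y s) \<le> B * w s t powr \<alpha>"
    and t: "is_partition a b n t" and d: "\<And>i. i < n \<Longrightarrow> t (Suc i) - t i < d"
    and s: "\<And>i. i < n \<Longrightarrow> s i \<in> {t i..t (Suc i)}"
    and u: "is_partition a b m u" and sub: "t ` {..n} \<subseteq> u ` {..m}"
  shows "norm ((\<Sum>i<n. x (s i) * (y (t (Suc i)) - y (t i)))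
               - (\<Sum>l<m. x (u l) * (y (u (Suc l)) - y (u l))))
           \<le> A * B * (young_const \<alpha> + 1) * w a b powr (2 * \<alpha>)"
proof -
  let ?C = "young_const \<alpha>"
  obtain k where k: "k 0 = 0" "k n = m" "\<And>i. i \<le> n \<Longrightarrow> k i \<le> m \<and> u (k i) = t i"
    "\<And>i. i < n \<Longrightarrow> k i \<le> k (Suc i)"
    using refinement_index_map [OF t u sub] by metis
  let ?F = "\<lambda>l. x (u l) * (y (u (Suc l)) - y (u l))"
  have blocks: "(\<Sum>l<m. ?F l) = (\<Sum>i<n. \<Sum>l = k i..<k (Suc i). ?F l)"
    using sum_over_blocks [of k n ?F] k by simp
  have block: "norm (x (s i) * (y (t (Suc i)) - y (t i)) - (\<Sum>l = k i..<k (Suc i). ?F l))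
      \<le> A * B * (?C + 1) * w (t i) (t (Suc i)) powr (2 * \<alpha>)" if i: "i < n" for i
  proof -
    let ?w = "w (t i) (t (Suc i))"
    have ti: "a \<le> t i" "t (Suc i) \<le> b" "t i \<le> s i" "s i \<le> t (Suc i)"
      using is_partition_bounds [OF t] s [OF i] i by auto
    have ki: "k i \<le> k (Suc i)" "k (Suc i) \<le> m" "u (k i) = t i" "u (k (Suc i)) = t (Suc i)"
      using k i by auto
    have in_block: "a \<le> u j" "u j \<le> b" "u j \<le> u l" "u l - u j < d" "u l \<le> b"
      if "k i \<le> j" "j \<le> l" "l \<le> k (Suc i)" for j l
      using is_partition_le [OF u, of "k i" j] is_partition_le [OF u, of j l]
        is_partition_le [OF u, of l "k (Suc i)"] that ki ti d [OF i] by auto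
    have "norm ((\<Sum>l = k i..<k (Suc i). ?F l) - x (u (k i)) * (y (u (k (Suc i))) - y (u (k i))))
        \<le> A * B * ?C * w (u (k i)) (u (k (Suc i))) powr (2 * \<alpha>)"
    proof (rule discrete_young_loeve [where m = "k i" and n = "k (Suc i)" and w = "\<lambda>j l. w (u j) (u l)"
          and x = "\<lambda>l. x (u l)" and y = "\<lambda>l. y (u l)"])
      fix j l assume "k i \<le> j" "j \<le> l" "l \<le> k (Suc i)"
      note b = in_block [OF this]
      show "0 \<le> w (u j) (u l)" using w b by (simp add: control_on_def)
      show "norm (x (u l) - x (u j)) \<le> A * w (u j) (u l) powr \<alpha>" by (intro x b)
      show "norm (y (u l) - y (u j)) \<le> B * w (u j) (u l) powr \<alpha>" by (intro y b)
    next
      fix j l q assume "k i \<le> j" "j \<le> l" "l \<le> q" "q \<le> k (Suc i)"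
      then show "w (u j) (u l) + w (u l) (u q) \<le> w (u j) (u q)"
        using in_block [of j l] in_block [of l q] w by (simp add: control_on_def)
    qed (use \<alpha> AB ki in auto)
    then have n1: "norm ((\<Sum>l = k i..<k (Suc i). ?F l) - x (t i) * (y (t (Suc i)) - y (t i)))
        \<le> A * B * ?C * ?w powr (2 * \<alpha>)" by (simp add: ki)
    have n2: "norm ((x (s i) - x (t i)) * (y (t (Suc i)) - y (t i))) \<le> A * B * ?w powr (2 * \<alpha>)"
    proof -
      have "norm (x (s i) - x (t i)) \<le> A * w (t i) (s i) powr \<alpha>" using ti by (intro x) auto
      also have "\<dots> \<le> A * ?w powr \<alpha>"
        using control_mono [OF w, of "t i" "t i" "s i" "t (Suc i)"] ti AB \<alpha>
        by (intro mult_left_mono powr_mono2) auto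
      finally have "norm ((x (s i) - x (t i)) * (y (t (Suc i)) - y (t i)))
          \<le> (A * ?w powr \<alpha>) * (B * ?w powr \<alpha>)"
        unfolding norm_mult using ti AB d [OF i] by (intro mult_mono y) auto
      also have "\<dots> = A * B * ?w powr (2 * \<alpha>)" unfolding mult_2 powr_add by simp
      finally show ?thesis .
    qed
    have "x (s i) * (y (t (Suc i)) - y (t i)) - (\<Sum>l = k i..<k (Suc i). ?F l)
        = (x (s i) - x (t i)) * (y (t (Suc i)) - y (t i))
          - ((\<Sum>l = k i..<k (Suc i). ?F l) - x (t i) * (y (t (Suc i)) - y (t i)))"
      by (simp add: algebra_simps)
    also have "norm \<dots> \<le> A * B * ?w powr (2 * \<alpha>) + A * B * ?C * ?w powr (2 * \<alpha>)"
      by (intro order_trans [OF norm_triangle_ineq4] add_mono n1 n2)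
    finally show ?thesis by (simp add: algebra_simps)
  qed
  have "norm ((\<Sum>i<n. x (s i) * (y (t (Suc i)) - y (t i))) - (\<Sum>l<m. ?F l))
      \<le> (\<Sum>i<n. A * B * (?C + 1) * w (t i) (t (Suc i)) powr (2 * \<alpha>))"
    unfolding blocks sum_subtractf [symmetric] by (intro order_trans [OF norm_sum] sum_mono block) auto
  also have "\<dots> = A * B * (?C + 1) * (\<Sum>i<n. w (t i) (t (Suc i)) powr (2 * \<alpha>))"
    by (simp add: sum_distrib_left)
  also have "\<dots> \<le> A * B * (?C + 1) * w a b powr (2 * \<alpha>)"
    using control_partition_powr_sum [OF w t, of "2 * \<alpha>"] \<alpha> AB young_const_fixed_point(1) [OF \<alpha>]
    by (intro mult_left_mono) auto
  finally show ?thesis .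
qed

section \<open>Existence and size of the Young integral\<close>

lemma has_young_integral_Cauchy:
  assumes ab: "a \<le> b"
    and C: "\<And>e. 0 < e \<Longrightarrow> \<exists>d>0. \<forall>n t s n' t' s'.
      is_partition a b n t \<and> (\<forall>i<n. t (Suc i) - t i < d) \<and> (\<forall>i<n. s i \<in> {t i..t (Suc i)}) \<longrightarrow>
      is_partition a b n' t' \<and> (\<forall>i<n'. t' (Suc i) - t' i < d) \<and> (\<forall>i<n'. s' i \<in> {t' i..t' (Suc i)}) \<longrightarrow>
      norm ((\<Sum>i<n. x (s i) * (y (t (Suc i)) - y (t i)))
            - (\<Sum>i<n'. x (s' i) * (y (t' (Suc i)) - y (t' i)))) < e"
  shows "\<exists>I. has_young_integral a b x y I"
proof -
  define admissible where "admissible d n t s \<longleftrightarrow> is_partition a b n t \<and>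
    (\<forall>i<n. t (Suc i) - t i < d) \<and> (\<forall>i<n. s i \<in> {t i..t (Suc i)})" for d n and t s :: "nat \<Rightarrow> real"
  define S where "S n t s = (\<Sum>i<n. x (s i) * (y (t (Suc i)) - y (t i)))" for n and t s :: "nat \<Rightarrow> real"
  have C': "\<exists>d>0. \<forall>n t s n' t' s'. admissible d n t s \<longrightarrow> admissible d n' t' s' \<longrightarrow>
      norm (S n t s - S n' t' s') < e" if "0 < e" for e
    using C [OF that] unfolding admissible_def S_def .
  have "\<exists>n t. admissible (inverse (real (Suc N))) n t t" for N
  proof -
    obtain n t where t: "is_partition a b n t" "\<forall>i<n. t (Suc i) - t i < inverse (real (Suc N))"
      using fine_partition_exists [OF ab, of "inverse (real (Suc N))"] by auto
    then have "\<forall>i<n. t i \<in> {t i..t (Suc i)}" by (auto simp: is_partition_def less_imp_le)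
    with t show ?thesis unfolding admissible_def by blast
  qed
  then obtain n t where nt: "\<And>N. admissible (inverse (real (Suc N))) (n N) (t N) (t N)" by metis
  have mono: "admissible d' n t s" if "admissible d n t s" "d \<le> d'" for d d' n t s
    using that by (fastforce simp: admissible_def)
  define X where "X N = S (n N) (t N) (t N)" for N
  have ev: "\<exists>N0. \<forall>N\<ge>N0. admissible d (n N) (t N) (t N)" if d: "0 < d" for d
  proof -
    obtain N0 where N0: "inverse (real (Suc N0)) < d" using reals_Archimedean [OF d] by blast
    have "inverse (real (Suc N)) \<le> d" if "N0 \<le> N" for N
    proof -
      have "inverse (real (Suc N)) \<le> inverse (real (Suc N0))" using that by (intro le_imp_inverse_le) auto
      then show ?thesis using N0 by linarith
    qed
    then show ?thesis using mono [OF nt] by blast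
  qed
  have "Cauchy X"
  proof (rule metric_CauchyI)
    fix e :: real assume "0 < e"
    then obtain d where "d > 0" and d: "\<And>n t s n' t' s'. admissible d n t s \<Longrightarrow>
        admissible d n' t' s' \<Longrightarrow> norm (S n t s - S n' t' s') < e"
      using C' by meson
    obtain N0 where "\<And>N. N0 \<le> N \<Longrightarrow> admissible d (n N) (t N) (t N)" using ev [OF \<open>d > 0\<close>] by blast
    then show "\<exists>M. \<forall>m\<ge>M. \<forall>n\<ge>M. dist (X m) (X n) < e"
      unfolding X_def dist_norm using d by blast
  qed
  then obtain I where I: "X \<longlonglongrightarrow> I" using Cauchy_convergent_iff convergent_def by blast
  have "\<exists>d>0. \<forall>n t s. admissible d n t s \<longrightarrow> norm (S n t s - I) < e" if "0 < e" for e
  proof -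
    obtain d where "d > 0" and d: "\<And>n t s n' t' s'. admissible d n t s \<Longrightarrow>
        admissible d n' t' s' \<Longrightarrow> norm (S n t s - S n' t' s') < e / 2"
      using C' [of "e / 2"] \<open>0 < e\<close> by (metis half_gt_zero)
    obtain N0 where N0: "\<And>N. N0 \<le> N \<Longrightarrow> admissible d (n N) (t N) (t N)" using ev [OF \<open>d > 0\<close>] by blast
    have "norm (S n' t' s' - I) < e" if "admissible d n' t' s'" for n' t' s'
    proof -
      have "(\<lambda>N. norm (S n' t' s' - X N)) \<longlonglongrightarrow> norm (S n' t' s' - I)"
        by (intro tendsto_intros I)
      moreover have "\<forall>N\<ge>N0. norm (S n' t' s' - X N) \<le> e / 2"
        unfolding X_def using d [OF that N0] by (auto intro: less_imp_le)
      ultimately have "norm (S n' t' s' - I) \<le> e / 2" using LIMSEQ_le_const2 by blast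
      then show ?thesis using \<open>0 < e\<close> by simp
    qed
    then show ?thesis using \<open>d > 0\<close> by blast
  qed
  then show ?thesis unfolding has_young_integral_def admissible_def S_def by blast
qed

text \<open>The estimate for refinements at the exponent \<open>\<alpha>\<close> itself is bounded but not small, since \<open>w\<close> need not
  be small on short intervals. Lowering the exponent to some \<open>\<beta>\<close> with \<open>1 / 2 < \<beta> < \<alpha>\<close> leaves over a
  power of the increment of \<open>y\<close>, which is small on short intervals by uniform continuity. Two fine
  partitions are then compared through a common refinement.\<close>

theorem young_integral_exists:
  fixes x y :: "real \<Rightarrow> complex"
  assumes ab: "a \<le> b" and \<alpha>: "1 / 2 < \<alpha>" and AB: "0 \<le> A" "0 \<le> B" and w: "control_on a b w"
    and x: "\<And>s t. a \<le> s \<Longrightarrow> s \<le> t \<Longrightarrow> t \<le> b \<Longrightarrow> norm (x t - x s) \<le> A * w s t powr \<alpha>"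
    and y: "\<And>s t. a \<le> s \<Longrightarrow> s \<le> t \<Longrightarrow> t \<le> b \<Longrightarrow> norm (y t - y s) \<le> B * w s t powr \<alpha>"
    and cont: "continuous_on {a..b} y"
  shows "\<exists>I. has_young_integral a b x y I"
proof (rule has_young_integral_Cauchy [OF ab])
  fix e :: real assume e: "0 < e"
  define \<beta> where "\<beta> = (\<alpha> + 1 / 2) / 2"
  have \<beta>: "1 / 2 < \<beta>" "\<beta> < \<alpha>" using \<alpha> by (simp_all add: \<beta>_def)
  define W where "W = w a b"
  define A' where "A' = A * W powr (\<alpha> - \<beta>)"
  define B' where "B' = B powr (\<beta> / \<alpha>)"
  define \<rho> where "\<rho> = 1 - \<beta> / \<alpha>"
  have \<rho>: "0 < \<rho>" using \<alpha> \<beta> by (simp add: \<rho>_def)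
  have A': "0 \<le> A'" and B': "0 \<le> B'" using AB by (simp_all add: A'_def B'_def)
  define K where "K = A' * B' * (young_const \<beta> + 1) * W powr (2 * \<beta>)"
  have K: "0 \<le> K" using A' B' young_const_fixed_point(1) [OF \<beta>(1)] by (simp add: K_def)
  \<comment> \<open>The target oscillation of \<open>y\<close>: it makes \<open>K * \<eta> powr \<rho>\<close> less than \<open>e / 2\<close>; the summand \<open>1\<close>
    covers the case \<open>K = 0\<close>.\<close>
  define \<eta> where "\<eta> = (e / (2 * (K + 1))) powr (1 / \<rho>)"
  have \<eta>: "0 < \<eta>" using e K by (simp add: \<eta>_def)
  have \<eta>_powr: "\<eta> powr \<rho> = e / (2 * (K + 1))" using \<rho> e K by (simp add: \<eta>_def powr_powr)
  have "uniformly_continuous_on {a..b} y"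
    using cont by (intro compact_uniformly_continuous) auto
  then obtain d where d: "0 < d" "\<And>s t. s \<in> {a..b} \<Longrightarrow> t \<in> {a..b} \<Longrightarrow> dist t s < d \<Longrightarrow> dist (y t) (y s) < \<eta>"
    using \<eta> unfolding uniformly_continuous_on_def by metis
  have x': "norm (x t - x s) \<le> A' * w s t powr \<beta>" if "a \<le> s" "s \<le> t" "t \<le> b" for s t
  proof -
    have "w s t powr \<alpha> = w s t powr (\<alpha> - \<beta>) * w s t powr \<beta>" by (simp flip: powr_add)
    also have "\<dots> \<le> W powr (\<alpha> - \<beta>) * w s t powr \<beta>"
      unfolding W_def using control_mono [OF w, of a s t b] that \<beta>
      by (intro mult_right_mono powr_mono2) auto
    finally have "A * w s t powr \<alpha> \<le> A' * w s t powr \<beta>"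
      using AB(1) unfolding A'_def mult.assoc by (rule mult_left_mono)
    then show ?thesis using x [OF that] by simp
  qed
  have y': "norm (y t - y s) \<le> (B' * \<eta> powr \<rho>) * w s t powr \<beta>"
    if "a \<le> s" "s \<le> t" "t \<le> b" "t - s < d" for s t
  proof -
    have "norm (y t - y s) = norm (y t - y s) powr (\<beta> / \<alpha> + \<rho>)" by (simp add: \<rho>_def)
    also have "\<dots> = norm (y t - y s) powr (\<beta> / \<alpha>) * norm (y t - y s) powr \<rho>"
      by (rule powr_add)
    also have "\<dots> \<le> (B * w s t powr \<alpha>) powr (\<beta> / \<alpha>) * \<eta> powr \<rho>"
      using y [of s t] d(2) [of s t] that \<rho> \<alpha> \<beta>
      by (intro mult_mono powr_mono2) (auto simp: dist_norm intro: less_imp_le)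
    also have "\<dots> = (B' * \<eta> powr \<rho>) * w s t powr \<beta>"
      using AB \<alpha> by (simp add: powr_mult powr_powr B'_def)
    finally show ?thesis .
  qed
  have bound: "A' * (B' * \<eta> powr \<rho>) * (young_const \<beta> + 1) * w a b powr (2 * \<beta>) < e / 2"
  proof -
    have "A' * (B' * \<eta> powr \<rho>) * (young_const \<beta> + 1) * w a b powr (2 * \<beta>) = K * \<eta> powr \<rho>"
      by (simp add: K_def W_def)
    also have "\<dots> < e / 2" unfolding \<eta>_powr using e K by (simp add: field_simps)
    finally show ?thesis .
  qed
  show "\<exists>d>0. \<forall>n t s n' t' s'.
      is_partition a b n t \<and> (\<forall>i<n. t (Suc i) - t i < d) \<and> (\<forall>i<n. s i \<in> {t i..t (Suc i)}) \<longrightarrow>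
      is_partition a b n' t' \<and> (\<forall>i<n'. t' (Suc i) - t' i < d) \<and> (\<forall>i<n'. s' i \<in> {t' i..t' (Suc i)}) \<longrightarrow>
      norm ((\<Sum>i<n. x (s i) * (y (t (Suc i)) - y (t i)))
            - (\<Sum>i<n'. x (s' i) * (y (t' (Suc i)) - y (t' i)))) < e"
  proof (intro exI [of _ d] conjI allI impI d(1))
    fix n n' and t s t' s' :: "nat \<Rightarrow> real"
    assume P: "is_partition a b n t \<and> (\<forall>i<n. t (Suc i) - t i < d) \<and> (\<forall>i<n. s i \<in> {t i..t (Suc i)})"
      and P': "is_partition a b n' t' \<and> (\<forall>i<n'. t' (Suc i) - t' i < d) \<and> (\<forall>i<n'. s' i \<in> {t' i..t' (Suc i)})"
    have "\<exists>m u. is_partition a b m u \<and> u ` {..m} = t ` {..n} \<union> t' ` {..n'}"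
    proof (rule partition_of_finite_set)
      show "a \<in> t ` {..n} \<union> t' ` {..n'}" "b \<in> t ` {..n} \<union> t' ` {..n'}"
        using P by (auto simp: is_partition_def)
      show "t ` {..n} \<union> t' ` {..n'} \<subseteq> {a..b}"
        using P P' is_partition_bounds by auto
    qed auto
    then obtain m u where u: "is_partition a b m u" "u ` {..m} = t ` {..n} \<union> t' ` {..n'}" by blast
    let ?U = "\<Sum>l<m. x (u l) * (y (u (Suc l)) - y (u l))"
    have close: "norm ((\<Sum>i<n. x (s i) * (y (t (Suc i)) - y (t i))) - ?U) < e / 2"
      if "is_partition a b n t \<and> (\<forall>i<n. t (Suc i) - t i < d) \<and> (\<forall>i<n. s i \<in> {t i..t (Suc i)})"
        "t ` {..n} \<subseteq> u ` {..m}" for n and t s :: "nat \<Rightarrow> real"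
      using that B' \<eta>
      by (intro le_less_trans [OF tagged_sum_refinement [OF \<beta>(1) A' _ w x' y' _ _ _ u(1)] bound]) auto
    show "norm ((\<Sum>i<n. x (s i) * (y (t (Suc i)) - y (t i)))
            - (\<Sum>i<n'. x (s' i) * (y (t' (Suc i)) - y (t' i)))) < e"
      using norm_diff_triangle_less [OF close [OF P] close [OF P', THEN norm_minus_commute [THEN eq_refl, THEN le_less_trans]]] u(2)
      by simp
  qed
qed

text \<open>The discrete estimate does not involve the number of points, so it survives the limit over
  partitions with left end points as tags.\<close>

theorem young_integral_bound:
  fixes x y :: "real \<Rightarrow> complex"
  assumes ab: "a \<le> b" and \<alpha>: "1 / 2 < \<alpha>" and AB: "0 \<le> A" "0 \<le> B" and w: "control_on a b w"
    and x: "\<And>s t. a \<le> s \<Longrightarrow> s \<le> t \<Longrightarrow> t \<le> b \<Longrightarrow> norm (x t - x s) \<le> A * w s t powr \<alpha>"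
    and y: "\<And>s t. a \<le> s \<Longrightarrow> s \<le> t \<Longrightarrow> t \<le> b \<Longrightarrow> norm (y t - y s) \<le> B * w s t powr \<alpha>"
    and I: "has_young_integral a b x y I"
  shows "norm (I - x a * (y b - y a)) \<le> A * B * young_const \<alpha> * w a b powr (2 * \<alpha>)"
proof (rule field_le_epsilon)
  fix e :: real assume "0 < e"
  then obtain d where "d > 0" and d: "\<And>n t s. is_partition a b n t \<Longrightarrow> \<forall>i<n. t (Suc i) - t i < d \<Longrightarrow>
      \<forall>i<n. s i \<in> {t i..t (Suc i)} \<Longrightarrow>
      norm ((\<Sum>i<n. x (s i) * (y (t (Suc i)) - y (t i))) - I) < e"
    using I [unfolded has_young_integral_def, THEN spec, THEN mp, OF \<open>0 < e\<close>] by blast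
  obtain n t where t: "is_partition a b n t" "\<forall>i<n. t (Suc i) - t i < d"
    using fine_partition_exists [OF ab \<open>d > 0\<close>] by blast
  let ?S = "\<Sum>i<n. x (t i) * (y (t (Suc i)) - y (t i))"
  have "norm (?S - I) < e"
    using t by (intro d) (auto simp: is_partition_def less_imp_le)
  moreover have "norm (?S - x a * (y b - y a)) \<le> A * B * young_const \<alpha> * w a b powr (2 * \<alpha>)"
  proof -
    have "norm ((\<Sum>l = 0..<n. x (t l) * (y (t (Suc l)) - y (t l))) - x (t 0) * (y (t n) - y (t 0)))
        \<le> A * B * young_const \<alpha> * w (t 0) (t n) powr (2 * \<alpha>)"
    proof (rule discrete_young_loeve [where m = 0 and n = n and w = "\<lambda>j l. w (t j) (t l)"
          and x = "\<lambda>l. x (t l)" and y = "\<lambda>l. y (t l)"])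
      fix j l assume jl: "j \<le> l" "l \<le> n"
      note b = is_partition_bounds(1) [OF t(1), of j] is_partition_le [OF t(1) jl]
        is_partition_bounds(2) [OF t(1) jl(2)]
      have j: "a \<le> t j" using b(1) jl by simp
      show "0 \<le> w (t j) (t l)" using w j b by (simp add: control_on_def)
      show "norm (x (t l) - x (t j)) \<le> A * w (t j) (t l) powr \<alpha>" by (intro x j b)
      show "norm (y (t l) - y (t j)) \<le> B * w (t j) (t l) powr \<alpha>" by (intro y j b)
    next
      fix j l q assume "j \<le> l" "l \<le> q" "q \<le> n"
      then show "w (t j) (t l) + w (t l) (t q) \<le> w (t j) (t q)"
        using is_partition_bounds [OF t(1)] is_partition_le [OF t(1)] w by (simp add: control_on_def)
    qed (use \<alpha> AB in auto)
    then show ?thesis using t(1) by (simp add: is_partition_def lessThan_atLeast0)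
  qed
  ultimately show "norm (I - x a * (y b - y a)) \<le> A * B * young_const \<alpha> * w a b powr (2 * \<alpha>) + e"
    using norm_triangle_ineq4 [of "?S - x a * (y b - y a)" "?S - I"] by simp
qed

lemma young_integral_eqI:
  assumes "a \<le> b" "has_young_integral a b x y I"
  shows "young_integral a b x y = I"
  unfolding young_integral_def using assms has_young_integral_unique by blast

text \<open>Stating the combination on the level of the products covers linearity in the integrand and in
  the integrator by one argument.\<close>

lemma has_young_integral_combine:
  assumes I: "has_young_integral a b x y I" and J: "has_young_integral a b x' y' J"
    and sums: "\<And>s u v. X s * (Y v - Y u) = c * (x s * (y v - y u)) + d * (x' s * (y' v - y' u))"
  shows "has_young_integral a b X Y (c * I + d * J)"
  unfolding has_young_integral_def
proof (intro allI impI)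
  fix e :: real assume e: "0 < e"
  define K where "K = norm c + norm d + 1"
  have K: "0 < K" by (simp add: K_def add_nonneg_pos)
  then have eK: "0 < e / K" using e by simp
  obtain d1 where d1: "d1 > 0"
    "\<And>n t s. is_partition a b n t \<Longrightarrow> \<forall>i<n. t (Suc i) - t i < d1 \<Longrightarrow> \<forall>i<n. s i \<in> {t i..t (Suc i)} \<Longrightarrow>
      norm ((\<Sum>i<n. x (s i) * (y (t (Suc i)) - y (t i))) - I) < e / K"
    using I [unfolded has_young_integral_def, THEN spec, THEN mp, OF eK] by blast
  obtain d2 where d2: "d2 > 0"
    "\<And>n t s. is_partition a b n t \<Longrightarrow> \<forall>i<n. t (Suc i) - t i < d2 \<Longrightarrow> \<forall>i<n. s i \<in> {t i..t (Suc i)} \<Longrightarrow>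
      norm ((\<Sum>i<n. x' (s i) * (y' (t (Suc i)) - y' (t i))) - J) < e / K"
    using J [unfolded has_young_integral_def, THEN spec, THEN mp, OF eK] by blast
  show "\<exists>r>0. \<forall>n t s. is_partition a b n t \<and> (\<forall>i<n. t (Suc i) - t i < r) \<and> (\<forall>i<n. s i \<in> {t i..t (Suc i)}) \<longrightarrow>
      norm ((\<Sum>i<n. X (s i) * (Y (t (Suc i)) - Y (t i))) - (c * I + d * J)) < e"
  proof (intro exI [of _ "min d1 d2"] conjI allI impI)
    show "0 < min d1 d2" using d1(1) d2(1) by simp
    fix n and t s :: "nat \<Rightarrow> real"
    assume P: "is_partition a b n t \<and> (\<forall>i<n. t (Suc i) - t i < min d1 d2) \<and> (\<forall>i<n. s i \<in> {t i..t (Suc i)})"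
    let ?P = "(\<Sum>i<n. x (s i) * (y (t (Suc i)) - y (t i))) - I"
    let ?Q = "(\<Sum>i<n. x' (s i) * (y' (t (Suc i)) - y' (t i))) - J"
    have "norm ?P < e / K" "norm ?Q < e / K" using P by (auto intro!: d1(2) d2(2))
    moreover have "(\<Sum>i<n. X (s i) * (Y (t (Suc i)) - Y (t i))) - (c * I + d * J) = c * ?P + d * ?Q"
      unfolding sums sum.distrib sum_distrib_left [symmetric] by (simp add: algebra_simps)
    ultimately have "norm ((\<Sum>i<n. X (s i) * (Y (t (Suc i)) - Y (t i))) - (c * I + d * J))
        \<le> norm c * (e / K) + norm d * (e / K)"
      by (simp only:) (intro norm_triangle_le add_mono;
        simp only: norm_mult; intro mult_left_mono less_imp_le norm_ge_zero)
    also have "\<dots> < K * (e / K)"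
    proof -
      have "norm c * q + norm d * q < K * q" if "0 < q" for q
        using that by (simp add: K_def distrib_right)
      then show ?thesis using eK .
    qed
    finally show "norm ((\<Sum>i<n. X (s i) * (Y (t (Suc i)) - Y (t i))) - (c * I + d * J)) < e"
      using K by simp
  qed
qed

section \<open>Lipschitz constants\<close>

text \<open>The hull may have empty interior, so the derivative is taken within it. A hyperplane separating
  the convex set from \<open>0\<close> gives a rotation carrying it into the right half plane, where the principal
  branch \<open>Ln\<close> is holomorphic; any other branch differs from the rotated one by a constant.\<close>

lemma log_branch_has_field_derivative:
  assumes H: "convex H" "closed H" "0 \<notin> H" and G: "log_branch H G" and z: "z \<in> H"
  shows "(G has_field_derivative 1 / z) (at z within H)"
proof -
  obtain a b where a: "a \<noteq> 0" "0 < b" "\<And>u. u \<in> H \<Longrightarrow> b < inner a u"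
    using separating_hyperplane_closed_0 [OF H] by blast
  define c where "c = cnj a"
  have c: "c \<noteq> 0" using a by (simp add: c_def)
  have Re: "0 < Re (c * u)" if "u \<in> H" for u
    using a(2) a(3) [OF that] by (simp add: c_def inner_complex_def)
  then have nonpos: "c * u \<notin> \<real>\<^sub>\<le>\<^sub>0" "u \<noteq> 0" if "u \<in> H" for u
    using that H(3) by (force simp: complex_nonpos_Reals_iff)+
  define G' where "G' u = Ln (c * u) - Ln c" for u
  have deriv: "(G' has_field_derivative 1 / u) (at u within H)" if "u \<in> H" for u
    unfolding G'_def using nonpos [OF that] c
    by (auto intro!: derivative_eq_intros simp: field_simps)
  have "log_branch H G'"
    unfolding log_branch_def
  proof (intro conjI ballI)
    show "continuous_on H G'" using deriv DERIV_continuous_on by blast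
    show "exp (G' u) = u" if "u \<in> H" for u
      using nonpos [OF that] c by (simp add: G'_def exp_diff)
  qed
  then obtain k where k: "\<And>u. u \<in> H \<Longrightarrow> G u - G' u = k"
    using log_branch_diff_constant [OF G] convex_connected [OF H(1)] by blast
  have "((\<lambda>u. G' u + k) has_field_derivative 1 / z) (at z within H)"
    using DERIV_add [OF deriv [OF z] DERIV_const [of k]] by simp
  then show ?thesis
  proof (rule has_field_derivative_transform_within [OF _ zero_less_one z])
    show "G' u + k = G u" if "u \<in> H" for u using k [OF that] by (simp add: algebra_simps)
  qed
qed

text \<open>A mean value inequality needs a convex domain, and this is why the branch is extended to the hull:
  there \<open>E \<circ> G\<close> has derivative \<open>deriv E (G z) / z\<close>, and \<open>norm z\<close> is at least the distance
  from \<open>0\<close> to the hull.\<close>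

lemma entire_log_lipschitz:
  assumes A: "compact A" "connected A" and 0: "0 \<notin> convex hull A"
    and L: "log_branch A L" and E: "E holomorphic_on UNIV" and uv: "u \<in> A" "v \<in> A"
  defines "H \<equiv> convex hull A" and "G \<equiv> log_hull A L"
  shows "norm (E (L u) - E (L v))
           \<le> (SUP z\<in>H. norm (deriv E (G z))) / infdist 0 H * norm (u - v)"
    and "0 \<le> (SUP z\<in>H. norm (deriv E (G z))) / infdist 0 H"
proof -
  have "A \<noteq> {}" using uv by blast
  then have G: "log_branch H G" "\<And>z. z \<in> A \<Longrightarrow> G z = L z"
    using theI' [OF log_hull_unique_extension [OF L A(2) _ 0]] by (auto simp: G_def H_def log_hull_def)
  have H: "compact H" "convex H" "closed H" "0 \<notin> H" "H \<noteq> {}" "A \<subseteq> H"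
    using A(1) 0 \<open>A \<noteq> {}\<close>
    by (auto simp: H_def compact_convex_hull compact_imp_closed hull_inc)
  have r: "0 < infdist 0 H" using H by (intro infdist_pos_not_in_closed) auto
  have contE': "continuous_on H (\<lambda>z. norm (deriv E (G z)))"
  proof -
    have "continuous_on UNIV (deriv E)"
      using E by (intro holomorphic_on_imp_continuous_on holomorphic_deriv) auto
    moreover have "continuous_on H G" using G(1) by (simp add: log_branch_def)
    ultimately show ?thesis
      by (intro continuous_on_norm continuous_on_compose2 [where f = G and g = "deriv E"]) auto
  qed
  have "bdd_above ((\<lambda>z. norm (deriv E (G z))) ` H)"
    using compact_continuous_image [OF contE' H(1)] by (intro bounded_imp_bdd_above compact_imp_bounded)
  then have sup: "norm (deriv E (G z)) \<le> (SUP z\<in>H. norm (deriv E (G z)))" if "z \<in> H" for z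
    using that by (intro cSUP_upper)
  have nonneg: "0 \<le> (SUP z\<in>H. norm (deriv E (G z)))"
    using sup uv(1) H(6) by (meson norm_ge_zero order_trans subsetD)
  then show "0 \<le> (SUP z\<in>H. norm (deriv E (G z))) / infdist 0 H" using r by simp
  have "norm (E (G u) - E (G v))
      \<le> (SUP z\<in>H. norm (deriv E (G z))) / infdist 0 H * norm (u - v)"
  proof (rule field_differentiable_bound [OF H(2), where f = "\<lambda>z. E (G z)"])
    fix z assume z: "z \<in> H"
    have "(E has_field_derivative deriv E (G z)) (at (G z))"
      using E holomorphic_derivI by blast
    then show "((\<lambda>z. E (G z)) has_field_derivative deriv E (G z) * (1 / z)) (at z within H)"
      by (rule DERIV_chain2 [OF _ log_branch_has_field_derivative [OF H(2,3,4) G(1) z]])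
    have "infdist 0 H \<le> norm z" using infdist_le [OF z, of 0] by simp
    then show "norm (deriv E (G z) * (1 / z)) \<le> (SUP z\<in>H. norm (deriv E (G z))) / infdist 0 H"
      unfolding norm_mult norm_divide using sup [OF z] nonneg r by (simp add: frac_le)
  qed (use uv H(6) in auto)
  then show "norm (E (L u) - E (L v))
      \<le> (SUP z\<in>H. norm (deriv E (G z))) / infdist 0 H * norm (u - v)"
    using uv G(2) by simp
qed

text \<open>For two fixed points the Lipschitz inequality is a closed condition on the constant, so it passes
  to the infimum over all constants.\<close>

lemma lipschitz_on_Lip_seminorm:
  assumes "u \<in> Lip S"
  shows "(Lip_seminorm S u)-lipschitz_on S u"
proof -
  let ?K = "{C. C-lipschitz_on S u}"
  have ne: "?K \<noteq> {}" using assms by (auto simp: Lip_def)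
  show ?thesis
  proof (rule lipschitz_onI)
    show "0 \<le> Lip_seminorm S u"
      unfolding Lip_seminorm_def using ne by (intro cInf_greatest) (auto dest: lipschitz_on_nonneg)
    fix x y assume xy: "x \<in> S" "y \<in> S"
    show "dist (u x) (u y) \<le> Lip_seminorm S u * dist x y"
    proof (cases "x = y")
      case False
      have "dist (u x) (u y) / dist x y \<le> Lip_seminorm S u"
        unfolding Lip_seminorm_def
      proof (rule cInf_greatest [OF ne])
        fix C assume "C \<in> ?K"
        then have "dist (u x) (u y) \<le> C * dist x y" using lipschitz_onD xy by blast
        then show "dist (u x) (u y) / dist x y \<le> C" using False by (simp add: divide_le_eq)
      qed
      then show ?thesis using False by (simp add: divide_le_eq)
    qed simp
  qed
qed

text \<open>\<open>M_bound\<close> is what the product rule gives as a Lipschitz constant of \<open>(E \<circ> L \<circ> f) \<cdot> g\<close>.\<close>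

lemma integrand_lipschitz:
  fixes S :: "'v::real_normed_vector set"
  assumes S: "compact S" "connected S" and f: "f \<in> Lip S" and g: "g \<in> Lip S"
    and 0: "0 \<notin> convex hull (f ` S)" and L: "log_branch (f ` S) L" and E: "E \<in> entire_functions"
    and xy: "x \<in> S" "y \<in> S"
  shows "norm (E (L (f x)) * g x - E (L (f y)) * g y) \<le> M_bound S L E f g * norm (x - y)"
    and "0 \<le> M_bound S L E f g"
proof -
  have E: "E holomorphic_on UNIV" using E by (simp add: entire_functions_def)
  note lf = lipschitz_on_Lip_seminorm [OF f] and lg = lipschitz_on_Lip_seminorm [OF g]
  note lnn = lipschitz_on_nonneg [OF lf] lipschitz_on_nonneg [OF lg]
  have cf: "continuous_on S f" and cg: "continuous_on S g"
    using lf lg by (auto intro: lipschitz_on_continuous_on)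
  have A: "compact (f ` S)" "connected (f ` S)"
    using S cf by (auto intro: compact_continuous_image connected_continuous_image)
  define a where "a = (SUP z\<in>f ` S. norm (E (L z)))"
  define b where "b = (SUP x\<in>S. norm (g x))"
  define D where "D = (SUP z\<in>convex hull (f ` S). norm (deriv E (log_hull (f ` S) L z))) /
    infdist 0 (convex hull (f ` S))"
  have M: "M_bound S L E f g = Lip_seminorm S g * a + Lip_seminorm S f * b * D"
    by (simp add: M_bound_def a_def b_def D_def)
  have a: "norm (E (L z)) \<le> a" if "z \<in> f ` S" for z
  proof -
    have "continuous_on (f ` S) (\<lambda>z. norm (E (L z)))"
      using L holomorphic_on_imp_continuous_on [OF E]
      by (intro continuous_on_norm continuous_on_compose2 [where f = L and g = E])
        (auto simp: log_branch_def)
    then have "compact ((\<lambda>z. norm (E (L z))) ` f ` S)"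
      using A(1) by (rule compact_continuous_image)
    then have "bdd_above ((\<lambda>z. norm (E (L z))) ` f ` S)"
      by (intro bounded_imp_bdd_above compact_imp_bounded)
    then show ?thesis unfolding a_def using that by (intro cSUP_upper)
  qed
  have b: "norm (g z) \<le> b" if "z \<in> S" for z
  proof -
    have "bdd_above ((\<lambda>z. norm (g z)) ` S)"
      using S(1) cg by (intro bounded_imp_bdd_above compact_imp_bounded compact_continuous_image continuous_intros)
    then show ?thesis unfolding b_def using that by (intro cSUP_upper)
  qed
  have ab: "0 \<le> a" "0 \<le> b"
    using a [of "f x"] b [of x] xy by (auto intro: order_trans [OF norm_ge_zero])
  have D: "norm (E (L (f x)) - E (L (f y))) \<le> D * norm (f x - f y)" "0 \<le> D"
    unfolding D_def using xy by (intro entire_log_lipschitz [OF A 0 L E]; blast)+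
  show "0 \<le> M_bound S L E f g" unfolding M using ab D(2) lnn by simp
  have "E (L (f x)) * g x - E (L (f y)) * g y
      = E (L (f x)) * (g x - g y) + (E (L (f x)) - E (L (f y))) * g y"
    by (simp add: algebra_simps)
  also have "norm \<dots> \<le> norm (E (L (f x))) * norm (g x - g y)
      + norm (E (L (f x)) - E (L (f y))) * norm (g y)"
    by (intro norm_triangle_le) (simp add: norm_mult)
  also have "\<dots> \<le> a * (Lip_seminorm S g * norm (x - y))
      + D * (Lip_seminorm S f * norm (x - y)) * b"
  proof (intro add_mono mult_mono)
    have "norm (f x - f y) \<le> Lip_seminorm S f * norm (x - y)"
      using lipschitz_onD [OF lf xy] by (simp add: dist_norm)
    then show "norm (E (L (f x)) - E (L (f y))) \<le> D * (Lip_seminorm S f * norm (x - y))"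
      using D by (meson mult_left_mono order_trans)
    show "norm (g x - g y) \<le> Lip_seminorm S g * norm (x - y)"
      using lipschitz_onD [OF lg xy] by (simp add: dist_norm)
  qed (use a b ab D(2) xy lnn in auto)
  also have "\<dots> = M_bound S L E f g * norm (x - y)" by (simp add: M algebra_simps)
  finally show "norm (E (L (f x)) * g x - E (L (f y)) * g y) \<le> M_bound S L E f g * norm (x - y)" .
qed

section \<open>The trilinear map\<close>

theorem corollary2p2:
  fixes \<gamma> :: "real \<Rightarrow> 'v::euclidean_space"
    and f :: "'v \<Rightarrow> complex" and L :: "complex \<Rightarrow> complex"
    and p T :: real and S :: "'v set"
  assumes "0 \<le> T" and "1 \<le> p" and "p < 2"
    and "continuous_on {0..T} \<gamma>" and "finite_p_variation p 0 T \<gamma>"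
    and "S = \<gamma> ` {0..T}"
    and "f \<in> Lip S" and "0 \<notin> convex hull (f ` S)" and "log_branch (f ` S) L"
  shows "(\<forall>E\<in>entire_functions. \<forall>g\<in>Lip S. \<forall>h\<in>Lip S.
            \<exists>I. has_young_integral 0 T (path_integrand \<gamma> f L E g) (h \<circ> \<gamma>) I)
       \<and> complex_trilinear_on entire_functions (Lip S) (Lip S) (I_map T \<gamma> f L)
       \<and> (\<forall>E\<in>entire_functions. \<forall>g\<in>Lip S. \<forall>h\<in>Lip S.
            norm (I_map T \<gamma> f L E g h)
              \<le> 1 / (1 - 2 powr (1 - 2 / p)) * M_bound S L E f g * Lip_seminorm S h
                  * (p_variation p 0 T \<gamma>)\<^sup>2
                + norm (E (L (f (\<gamma> 0)))) * norm (g (\<gamma> 0)) * norm (h (\<gamma> T) - h (\<gamma> 0)))"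
proof -
  have p: "0 < p" and \<alpha>: "1 / 2 < 1 / p" using assms(2,3) by (auto simp: field_simps)
  define w where "w s t = Sup (variation_sums p s t \<gamma>)" for s t
  have w: "control_on 0 T w"
    using variation_control(1) [OF assms(5) p] by (simp add: w_def [abs_def])
  have \<gamma>w: "norm (\<gamma> t - \<gamma> s) \<le> w s t powr (1 / p)" if "0 \<le> s" "s \<le> t" "t \<le> T" for s t
    using variation_control(2) [OF assms(5) p that] by (simp add: w_def)
  have S: "compact S" "connected S"
    using assms(4) unfolding assms(6)
    by (auto intro: compact_continuous_image connected_continuous_image)
  have in_S: "\<gamma> t \<in> S" if "0 \<le> t" "t \<le> T" for t using that by (simp add: assms(6))
  have x: "norm (path_integrand \<gamma> f L E g t - path_integrand \<gamma> f L E g s)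
      \<le> M_bound S L E f g * w s t powr (1 / p)"
    if "E \<in> entire_functions" "g \<in> Lip S" and st: "0 \<le> s" "s \<le> t" "t \<le> T" for E g s t
  proof -
    note M = integrand_lipschitz [OF S assms(7) that(2) assms(8,9) that(1) in_S [of t] in_S [of s]]
    have "norm (path_integrand \<gamma> f L E g t - path_integrand \<gamma> f L E g s)
        \<le> M_bound S L E f g * norm (\<gamma> t - \<gamma> s)"
      using M(1) st by (simp add: path_integrand_def)
    also have "\<dots> \<le> M_bound S L E f g * w s t powr (1 / p)"
      using M(2) st by (intro mult_left_mono \<gamma>w) auto
    finally show ?thesis .
  qed
  have M0: "0 \<le> M_bound S L E f g" if "E \<in> entire_functions" "g \<in> Lip S" for E g
    using integrand_lipschitz(2) [OF S assms(7) that(2) assms(8,9) that(1) in_S [of 0] in_S [of 0]] assms(1)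
    by simp
  have H0: "0 \<le> Lip_seminorm S h" if "h \<in> Lip S" for h
    using lipschitz_on_nonneg [OF lipschitz_on_Lip_seminorm [OF that]] .
  have y: "norm ((h \<circ> \<gamma>) t - (h \<circ> \<gamma>) s) \<le> Lip_seminorm S h * w s t powr (1 / p)"
    if "h \<in> Lip S" and st: "0 \<le> s" "s \<le> t" "t \<le> T" for h s t
  proof -
    have "norm ((h \<circ> \<gamma>) t - (h \<circ> \<gamma>) s) \<le> Lip_seminorm S h * norm (\<gamma> t - \<gamma> s)"
      using lipschitz_onD [OF lipschitz_on_Lip_seminorm [OF that(1)] in_S [of t] in_S [of s]] st
      by (simp add: dist_norm)
    also have "\<dots> \<le> Lip_seminorm S h * w s t powr (1 / p)"
      using H0 [OF that(1)] st by (intro mult_left_mono \<gamma>w) auto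
    finally show ?thesis .
  qed
  have cont: "continuous_on {0..T} (h \<circ> \<gamma>)" if "h \<in> Lip S" for h
    using lipschitz_on_continuous_on [OF lipschitz_on_Lip_seminorm [OF that]] assms(4)
    unfolding assms(6) by (intro continuous_on_compose)
  have ex: "\<exists>I. has_young_integral 0 T (path_integrand \<gamma> f L E g) (h \<circ> \<gamma>) I"
    if "E \<in> entire_functions" "g \<in> Lip S" "h \<in> Lip S" for E g h
    using that by (intro young_integral_exists [OF assms(1) \<alpha> M0 H0 w x y cont])
  have I: "has_young_integral 0 T (path_integrand \<gamma> f L E g) (h \<circ> \<gamma>) (I_map T \<gamma> f L E g h)"
    if "E \<in> entire_functions" "g \<in> Lip S" "h \<in> Lip S" for E g h
    using ex [OF that] young_integral_eqI [OF assms(1)] by (auto simp: I_map_def)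
  have eqI: "I_map T \<gamma> f L E g h = J"
    if "has_young_integral 0 T (path_integrand \<gamma> f L E g) (h \<circ> \<gamma>) J" for E g h J
    unfolding I_map_def using young_integral_eqI [OF assms(1) that] .
  have tri: "complex_trilinear_on entire_functions (Lip S) (Lip S) (I_map T \<gamma> f L)"
  proof -
    have "I_map T \<gamma> f L (\<lambda>z. E z + E' z) g h = I_map T \<gamma> f L E g h + I_map T \<gamma> f L E' g h"
      if "E \<in> entire_functions" "E' \<in> entire_functions" "g \<in> Lip S" "h \<in> Lip S" for E E' g h
      using has_young_integral_combine [OF I [of E g h] I [of E' g h], where c = 1 and d = 1] that
      by (intro eqI) (simp add: path_integrand_def algebra_simps)
    moreover have "I_map T \<gamma> f L (\<lambda>z. c * E z) g h = c * I_map T \<gamma> f L E g h"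
      if "E \<in> entire_functions" "g \<in> Lip S" "h \<in> Lip S" for c E g h
      using has_young_integral_combine [OF I [of E g h] I [of E g h], where c = c and d = 0] that
      by (intro eqI) (simp add: path_integrand_def algebra_simps)
    moreover have "I_map T \<gamma> f L E (\<lambda>z. g z + g' z) h = I_map T \<gamma> f L E g h + I_map T \<gamma> f L E g' h"
      if "E \<in> entire_functions" "g \<in> Lip S" "g' \<in> Lip S" "h \<in> Lip S" for E g g' h
      using has_young_integral_combine [OF I [of E g h] I [of E g' h], where c = 1 and d = 1] that
      by (intro eqI) (simp add: path_integrand_def algebra_simps)
    moreover have "I_map T \<gamma> f L E (\<lambda>z. c * g z) h = c * I_map T \<gamma> f L E g h"
      if "E \<in> entire_functions" "g \<in> Lip S" "h \<in> Lip S" for c E g h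
      using has_young_integral_combine [OF I [of E g h] I [of E g h], where c = c and d = 0] that
      by (intro eqI) (simp add: path_integrand_def algebra_simps)
    moreover have "I_map T \<gamma> f L E g (\<lambda>z. h z + h' z) = I_map T \<gamma> f L E g h + I_map T \<gamma> f L E g h'"
      if "E \<in> entire_functions" "g \<in> Lip S" "h \<in> Lip S" "h' \<in> Lip S" for E g h h'
      using has_young_integral_combine [OF I [of E g h] I [of E g h'], where c = 1 and d = 1] that
      by (intro eqI) (simp add: path_integrand_def algebra_simps)
    moreover have "I_map T \<gamma> f L E g (\<lambda>z. c * h z) = c * I_map T \<gamma> f L E g h"
      if "E \<in> entire_functions" "g \<in> Lip S" "h \<in> Lip S" for c E g h
      using has_young_integral_combine [OF I [of E g h] I [of E g h], where c = c and d = 0] that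
      by (intro eqI) (simp add: path_integrand_def algebra_simps)
    ultimately show ?thesis
      unfolding complex_trilinear_on_def complex_linear_on_def by simp
  qed
  have bound: "norm (I_map T \<gamma> f L E g h)
      \<le> 1 / (1 - 2 powr (1 - 2 / p)) * M_bound S L E f g * Lip_seminorm S h * (p_variation p 0 T \<gamma>)\<^sup>2
        + norm (E (L (f (\<gamma> 0)))) * norm (g (\<gamma> 0)) * norm (h (\<gamma> T) - h (\<gamma> 0))"
    if Egh: "E \<in> entire_functions" "g \<in> Lip S" "h \<in> Lip S" for E g h
  proof -
    let ?I = "I_map T \<gamma> f L E g h"
    let ?x = "path_integrand \<gamma> f L E g" and ?y = "h \<circ> \<gamma>"
    have "norm (?I - ?x 0 * (?y T - ?y 0))
        \<le> M_bound S L E f g * Lip_seminorm S h * young_const (1 / p) * w 0 T powr (2 * (1 / p))"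
      using Egh by (intro young_integral_bound [OF assms(1) \<alpha> M0 H0 w x y I])
    also have "w 0 T powr (2 * (1 / p)) = (p_variation p 0 T \<gamma>)\<^sup>2"
      unfolding mult_2 powr_add by (simp add: p_variation_def w_def power2_eq_square)
    finally have "norm (?I - ?x 0 * (?y T - ?y 0))
        \<le> 1 / (1 - 2 powr (1 - 2 / p)) * M_bound S L E f g * Lip_seminorm S h * (p_variation p 0 T \<gamma>)\<^sup>2"
      by (simp add: young_const_def)
    moreover have "norm (?x 0 * (?y T - ?y 0))
        = norm (E (L (f (\<gamma> 0)))) * norm (g (\<gamma> 0)) * norm (h (\<gamma> T) - h (\<gamma> 0))"
      by (simp add: path_integrand_def norm_mult)
    ultimately show ?thesis
      using norm_triangle_sub [of ?I "?x 0 * (?y T - ?y 0)"] by linarith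
  qed
  show ?thesis using ex tri bound by blast
qed

end
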